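(* Let $M$ be a finite dimensional module over the complex Lie algebra $sl_2(\mathbb C)\oplus sl_2(\mathbb C)\oplus sl_2(\mathbb C)$, and let $n_1,n_2,n_3$ be non-negative integers. Then the multiplicity $x_{n_1,n_2,n_3}$ of the irreducible module $V(n_1)\otimes V(n_2)\otimes V(n_3)$ in $M$ is $$ \begin{aligned} x_{n_1,n_2,n_3}=&\dim M_{(n_1,n_2,n_3)}-\dim M_{(n_1+2,n_2,n_3)}-\dim M_{(n_1,n_2+2,n_3)}-\dim M_{(n_1,n_2,n_3+2)}\\ &+\dim M_{(n_1+2,n_2+2,n_3)}+\dim M_{(n_1+2,n_2,n_3+2)}+\dim M_{(n_1,n_2+2,n_3+2)}-\dim M_{(n_1+2,n_2+2,n_3+2)}. \end{aligned} $$
   Context: For a non-negative integer $n$, $V(n)$ denotes the $(n+1)$-dimensional irreducible $sl_2(\mathbb C)$-module of highest weight $n$. The Lie algebra $sl_2(\mathbb C)\oplus sl_2(\mathbb C)\oplus sl_2(\mathbb C)$ acts on $V(n_1)\otimes V(n_2)\otimes V(n_3)$ by $(x,y,z)\cdot(v_1\otimes v_2\otimes v_3)=(x\cdot v_1)\otimes v_2\otimes v_3+v_1\otimes(y\cdot v_2)\otimes v_3+v_1\otimes v_2\otimes(z\cdot v_3)$; every finite dimensional irreducible module over this Lie algebra is isomorphic to exactly one such tensor product. Every finite dimensional module $M$ is completely reducible, and the multiplicity $x_{n_1,n_2,n_3}$ is the number of summands isomorphic to $V(n_1)\otimes V(n_2)\otimes V(n_3)$ in a decomposition of $M$ into irreducible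 submodules. Let $H_i$ ($i=1,2,3$) be the element $\begin{pmatrix}1&0\\0&-1\end{pmatrix}$ in the $i$-th copy of $sl_2(\mathbb C)$. For $(\mu_1,\mu_2,\mu_3)\in\mathbb C^3$, the weight space is $M_{(\mu_1,\mu_2,\mu_3)}=\{v\in M : H_i\cdot v=\mu_i v \text{ for } i=1,2,3\}$. *)

theory Defs
  imports "HOL-Analysis.Analysis" "HOL-Library.Function_Algebras"
begin

text \<open>
  The Lie algebra is a carrier \<open>L\<close> with scalar multiplication \<open>lscale\<close> and bracket \<open>br\<close>;
  the module is the whole type \<open>'v\<close>, and nothing is assumed about \<open>act\<close> outside \<open>L\<close>.
\<close>

locale lie_module = vector_space scale
  for L :: "'g::ab_group_add set"
    and lscale :: "complex \<Rightarrow> 'g \<Rightarrow> 'g"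
    and br :: "'g \<Rightarrow> 'g \<Rightarrow> 'g"
    and scale :: "complex \<Rightarrow> 'v::ab_group_add \<Rightarrow> 'v"
    and act :: "'g \<Rightarrow> 'v \<Rightarrow> 'v" +
  assumes act_add_left: "g \<in> L \<Longrightarrow> h \<in> L \<Longrightarrow> act (g + h) v = act g v + act h v"
    and act_scale_left: "g \<in> L \<Longrightarrow> act (lscale c g) v = scale c (act g v)"
    and act_add_right: "g \<in> L \<Longrightarrow> act g (v + w) = act g v + act g w"
    and act_scale_right: "g \<in> L \<Longrightarrow> act g (scale c v) = scale c (act g v)"
    and act_bracket: "g \<in> L \<Longrightarrow> h \<in> L \<Longrightarrow> act (br g h) v = act g (act h v) - act h (act g v)"
begin

definition submodule :: "'v set \<Rightarrow> bool" where
  "submodule W \<longleftrightarrow> subspace W \<and> (\<forall>g\<in>L. \<forall>w\<in>W. act g w \<in> W)"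

definition irreducible_submodule :: "'v set \<Rightarrow> bool" where
  "irreducible_submodule N \<longleftrightarrow>
     submodule N \<and> N \<noteq> {0} \<and> (\<forall>W. submodule W \<and> W \<subseteq> N \<longrightarrow> W = {0} \<or> W = N)"

text \<open>
  The summands may be collected in a set: they are nonzero, so distinct summands of a direct sum
  are distinct as subsets (isomorphic summands are still counted separately).
\<close>

definition irreducible_decomposition :: "'v set set \<Rightarrow> bool" where
  "irreducible_decomposition D \<longleftrightarrow>
     finite D \<and> (\<forall>N\<in>D. irreducible_submodule N) \<and>
     (\<forall>v. \<exists>!f. f \<in> (\<Pi>\<^sub>E N\<in>D. N) \<and> v = (\<Sum>N\<in>D. f N))"

end

definition module_isomorphic ::
  "'g set \<Rightarrow> (complex \<Rightarrow> 'v::ab_group_add \<Rightarrow> 'v) \<Rightarrow> ('g \<Rightarrow> 'v \<Rightarrow> 'v) \<Rightarrow> 'v set \<Rightarrow>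
   (complex \<Rightarrow> 'w::ab_group_add \<Rightarrow> 'w) \<Rightarrow> ('g \<Rightarrow> 'w \<Rightarrow> 'w) \<Rightarrow> 'w set \<Rightarrow> bool" where
  "module_isomorphic L smul act N smul' act' N' \<longleftrightarrow>
     (\<exists>\<phi>. bij_betw \<phi> N N' \<and>
       (\<forall>u\<in>N. \<forall>v\<in>N. \<phi> (u + v) = \<phi> u + \<phi> v) \<and>
       (\<forall>c. \<forall>v\<in>N. \<phi> (smul c v) = smul' c (\<phi> v)) \<and>
       (\<forall>g\<in>L. \<forall>v\<in>N. \<phi> (act g v) = act' g (\<phi> v)))"

type_synonym mat2 = "complex^2^2"

definition sl2 :: "mat2 set" where
  "sl2 = {x. trace x = 0}"

definition mat_scale :: "complex \<Rightarrow> mat2 \<Rightarrow> mat2" where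
  "mat_scale c x = (\<chi> i j. c * x $ i $ j)"

definition commutator :: "mat2 \<Rightarrow> mat2 \<Rightarrow> mat2" where
  "commutator x y = x ** y - y ** x"

definition H_mat :: mat2 where
  "H_mat = vector [vector [1, 0], vector [0, -1]]"

definition sl2_cubed :: "(mat2 \<times> mat2 \<times> mat2) set" where
  "sl2_cubed = sl2 \<times> sl2 \<times> sl2"

definition scale_cubed :: "complex \<Rightarrow> mat2 \<times> mat2 \<times> mat2 \<Rightarrow> mat2 \<times> mat2 \<times> mat2" where
  "scale_cubed c = (\<lambda>(x, y, z). (mat_scale c x, mat_scale c y, mat_scale c z))"

definition bracket_cubed ::
  "mat2 \<times> mat2 \<times> mat2 \<Rightarrow> mat2 \<times> mat2 \<times> mat2 \<Rightarrow> mat2 \<times> mat2 \<times> mat2" where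
  "bracket_cubed = (\<lambda>(x, y, z) (x', y', z'). (commutator x x', commutator y y', commutator z z'))"

definition H1 :: "mat2 \<times> mat2 \<times> mat2" where "H1 = (H_mat, 0, 0)"
definition H2 :: "mat2 \<times> mat2 \<times> mat2" where "H2 = (0, H_mat, 0)"
definition H3 :: "mat2 \<times> mat2 \<times> mat2" where "H3 = (0, 0, H_mat)"

definition fun_scale :: "complex \<Rightarrow> ('i \<Rightarrow> complex) \<Rightarrow> 'i \<Rightarrow> complex" where
  "fun_scale c f = (\<lambda>i. c * f i)"

text \<open>
  \<open>V(n)\<close> is the \<open>n\<close>-th symmetric power of the natural module \<open>\<complex>\<^sup>2\<close> with standard basis \<open>X, Y\<close>;
  the function \<open>f\<close> stands for \<open>\<Sum>j\<le>n. f j X\<^sup>n\<^sup>-\<^sup>j Y\<^sup>j\<close>. A matrix acts as the derivation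
  with \<open>X \<mapsto> x\<^sub>1\<^sub>1 X + x\<^sub>2\<^sub>1 Y\<close> and \<open>Y \<mapsto> x\<^sub>1\<^sub>2 X + x\<^sub>2\<^sub>2 Y\<close>, so that \<open>X\<^sup>n\<close> is a highest weight
  vector of weight \<open>n\<close>.
\<close>

definition V :: "nat \<Rightarrow> (nat \<Rightarrow> complex) set" where
  "V n = {f. \<forall>j>n. f j = 0}"

definition V_act :: "nat \<Rightarrow> mat2 \<Rightarrow> (nat \<Rightarrow> complex) \<Rightarrow> nat \<Rightarrow> complex" where
  "V_act n x f = (\<lambda>j.
     ((of_nat n - of_nat j) * x $ 1 $ 1 + of_nat j * x $ 2 $ 2) * f j
     + (of_nat j + 1) * x $ 1 $ 2 * f (j + 1)
     + (if j = 0 then 0 else (of_nat n - of_nat j + 1) * x $ 2 $ 1 * f (j - 1)))"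

definition pure_tensor ::
  "(nat \<Rightarrow> complex) \<Rightarrow> (nat \<Rightarrow> complex) \<Rightarrow> (nat \<Rightarrow> complex) \<Rightarrow> nat \<times> nat \<times> nat \<Rightarrow> complex" where
  "pure_tensor u v w = (\<lambda>(i, j, k). u i * v j * w k)"

definition V_tensor :: "nat \<Rightarrow> nat \<Rightarrow> nat \<Rightarrow> (nat \<times> nat \<times> nat \<Rightarrow> complex) set" where
  "V_tensor n\<^sub>1 n\<^sub>2 n\<^sub>3 =
     module.span fun_scale {pure_tensor u v w | u v w. u \<in> V n\<^sub>1 \<and> v \<in> V n\<^sub>2 \<and> w \<in> V n\<^sub>3}"

text \<open>Each matrix acts on its own tensor factor, with the other two indices held fixed.\<close>

definition V_tensor_act ::
  "nat \<Rightarrow> nat \<Rightarrow> nat \<Rightarrow> mat2 \<times> mat2 \<times> mat2 \<Rightarrow>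
   (nat \<times> nat \<times> nat \<Rightarrow> complex) \<Rightarrow> nat \<times> nat \<times> nat \<Rightarrow> complex" where
  "V_tensor_act n\<^sub>1 n\<^sub>2 n\<^sub>3 = (\<lambda>(x, y, z) t (i, j, k).
     V_act n\<^sub>1 x (\<lambda>i'. t (i', j, k)) i
     + V_act n\<^sub>2 y (\<lambda>j'. t (i, j', k)) j
     + V_act n\<^sub>3 z (\<lambda>k'. t (i, j, k')) k)"

lemma V_tensor_act_pure_tensor:
  "V_tensor_act n\<^sub>1 n\<^sub>2 n\<^sub>3 (x, y, z) (pure_tensor u v w) =
     pure_tensor (V_act n\<^sub>1 x u) v w + pure_tensor u (V_act n\<^sub>2 y v) w
     + pure_tensor u v (V_act n\<^sub>3 z w)"
  by (rule ext) (auto simp: V_tensor_act_def pure_tensor_def V_act_def algebra_simps)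

lemma V_act_closed: "f \<in> V n \<Longrightarrow> V_act n x f \<in> V n"
proof -
  assume f: "f \<in> V n"
  have "V_act n x f j = 0" if "n < j" for j
  proof (cases "j = n + 1")
    case False
    then have "n < j - 1" using that by simp
    then show ?thesis using f that by (simp add: V_def V_act_def)
  qed (use f in \<open>simp add: V_def V_act_def\<close>)
  then show ?thesis by (simp add: V_def)
qed

lemma vector_space_fun_scale: "vector_space fun_scale"
  by unfold_locales (auto simp: fun_scale_def algebra_simps)

text \<open>The formulas for the action make sense on all functions, not only those in \<open>V n\<close>.\<close>

lemma lie_module_V: "lie_module sl2 mat_scale commutator fun_scale (V_act n)"
proof -
  interpret vector_space "fun_scale :: complex \<Rightarrow> (nat \<Rightarrow> complex) \<Rightarrow> _"
    by (rule vector_space_fun_scale)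
  show ?thesis
  proof unfold_locales
    fix g h :: mat2 and v :: "nat \<Rightarrow> complex"
    assume "g \<in> sl2" "h \<in> sl2"
    then have tr: "g $ 2 $ 2 = - g $ 1 $ 1" "h $ 2 $ 2 = - h $ 1 $ 1"
      by (auto simp: sl2_def trace_def sum_2 eq_neg_iff_add_eq_0 add.commute)
    show "V_act n (commutator g h) v = V_act n g (V_act n h v) - V_act n h (V_act n g v)"
    proof
      fix j
      show "V_act n (commutator g h) v j
        = (V_act n g (V_act n h v) - V_act n h (V_act n g v)) j"
        by (cases j; cases "j - 1")
          (auto simp: V_act_def commutator_def matrix_matrix_mult_def sum_2 tr algebra_simps)
    qed
  qed (auto simp: V_act_def fun_scale_def mat_scale_def algebra_simps)
qed

locale sl2_cubed_module =
  lie_module sl2_cubed scale_cubed bracket_cubed scale act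
  for scale :: "complex \<Rightarrow> 'v::ab_group_add \<Rightarrow> 'v"
    and act :: "mat2 \<times> mat2 \<times> mat2 \<Rightarrow> 'v \<Rightarrow> 'v"
begin

definition weight_space :: "complex \<times> complex \<times> complex \<Rightarrow> 'v set" where
  "weight_space = (\<lambda>(\<mu>\<^sub>1, \<mu>\<^sub>2, \<mu>\<^sub>3).
     {v. act H1 v = scale \<mu>\<^sub>1 v \<and> act H2 v = scale \<mu>\<^sub>2 v \<and> act H3 v = scale \<mu>\<^sub>3 v})"

definition summand_count :: "'v set set \<Rightarrow> nat \<Rightarrow> nat \<Rightarrow> nat \<Rightarrow> nat" where
  "summand_count D n\<^sub>1 n\<^sub>2 n\<^sub>3 =
     card {N \<in> D. module_isomorphic sl2_cubed scale act N
       fun_scale (V_tensor_act n\<^sub>1 n\<^sub>2 n\<^sub>3) (V_tensor n\<^sub>1 n\<^sub>2 n\<^sub>3)}"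

text \<open>
  The description determines a value only when a decomposition exists and the count does not
  depend on it; both hold for finite-dimensional modules.
\<close>

definition multiplicity :: "nat \<Rightarrow> nat \<Rightarrow> nat \<Rightarrow> nat" where
  "multiplicity n\<^sub>1 n\<^sub>2 n\<^sub>3 =
     (THE m. \<exists>D. irreducible_decomposition D \<and> m = summand_count D n\<^sub>1 n\<^sub>2 n\<^sub>3)"

end

end

theory Submission
  imports Defs "HOL-Computational_Algebra.Fundamental_Theorem_Algebra"
begin

text \<open>
  Let \<open>E\<^sub>i, F\<^sub>i, H\<^sub>i\<close> be the standard basis elements of the \<open>i\<close>-th copy. In an irreducible module the
  vectors annihilated by all \<open>E\<^sub>i\<close> form a line, of weight \<open>(n\<^sub>1, n\<^sub>2, n\<^sub>3)\<close> precisely when the module is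
  isomorphic to \<open>V(n\<^sub>1) \<otimes> V(n\<^sub>2) \<otimes> V(n\<^sub>3)\<close>. So in any irreducible decomposition the multiplicity is
  the dimension of the space of highest weight vectors of that weight.

  For one copy, \<open>E\<close> maps the weight space of weight \<open>a \<ge> 0\<close> onto that of weight \<open>a + 2\<close>; an explicit
  preimage is a combination of the vectors \<open>F\<^sup>k\<^sup>+\<^sup>1 E\<^sup>k w\<close>. Hence the dimension of the kernel of \<open>E\<close> is a
  difference of two weight space dimensions. The weight spaces and kernels belonging to one copy are
  stable under the other two, so three such differences can be taken in succession, which gives the
  alternating sum.

  The same preimages show that \<open>H\<close> is diagonalisable and that the module is generated by highest
  weight vectors under the \<open>F\<^sub>i\<close>. As each of these generates an irreducible submodule, the irreducible
  submodules span the module, and a direct family of them of maximal cardinality is a decomposition.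
\<close>

section \<open>Operators on finite-dimensional vector spaces\<close>

context finite_dimensional_vector_space
begin

text \<open>The first \<open>dimension + 1\<close> terms suffice: distinct terms are too many to be
  independent, and a repeated term gives a relation with coefficients 1 and -1. Working with indexed
  terms rather than a set covers sequences with repetitions.\<close>

lemma infinite_sequence_dependent:
  fixes x :: "nat \<Rightarrow> 'b"
  obtains n c i where "i \<le> n" "c i \<noteq> 0" "(\<Sum>i\<le>n. scale (c i) (x i)) = 0"
proof -
  let ?n = "dimension"
  show ?thesis
  proof (cases "inj_on x {..?n}")
    case True
    have "dependent (x ` {..?n})"
    proof (rule ccontr)
      assume "independent (x ` {..?n})"
      then have "card (x ` {..?n}) \<le> dim UNIV"
        by (intro independent_card_le_dim) auto
      then show False
        using True by (simp add: card_image dimension_def)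
    qed
    then obtain u v where u: "v \<in> x ` {..?n}" "u v \<noteq> 0"
        "(\<Sum>w\<in>x ` {..?n}. scale (u w) w) = 0"
      by (auto simp: dependent_finite)
    then obtain i where "i \<le> ?n" "v = x i" by auto
    moreover have "(\<Sum>i\<le>?n. scale (u (x i)) (x i)) = 0"
      using u(3) by (simp add: sum.reindex[OF True])
    ultimately show ?thesis
      using that[of i ?n "u \<circ> x"] u(2) by simp
  next
    case False
    then obtain i j where ij: "i \<le> ?n" "j \<le> ?n" "i \<noteq> j" "x i = x j"
      by (auto simp: inj_on_def)
    let ?c = "\<lambda>k. if k = i then 1 else if k = j then -1 else (0::'a)"
    have "(\<Sum>k\<le>?n. scale (?c k) (x k)) = (\<Sum>k\<in>{i, j}. scale (?c k) (x k))"
      using ij by (intro sum.mono_neutral_right) auto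
    also have "\<dots> = 0" using ij by simp
    finally show ?thesis using that[of i ?n ?c] ij by simp
  qed
qed

text \<open>Nonzero eigenvectors for distinct eigenvalues would be independent, and there is no room
  for infinitely many. This is the source of all nilpotency statements below.\<close>

lemma eigenvectors_vanish:
  assumes T: "Vector_Spaces.linear scale scale T"
    and eig: "\<And>k::nat. T (x k) = scale (\<mu> k) (x k)"
    and inj: "inj \<mu>"
  shows "\<exists>k. x k = 0"
proof (rule ccontr)
  interpret T: Vector_Spaces.linear scale scale T by fact
  assume nz: "\<nexists>k. x k = 0"
  have indep: "\<forall>i\<le>n. c i = 0" if "(\<Sum>i\<le>n. scale (c i) (x i)) = 0" for n c
    using that
  proof (induction n arbitrary: c)
    case 0
    then show ?case using nz by simp
  next
    case (Suc n)
    let ?s = "\<Sum>i\<le>Suc n. scale (c i) (x i)"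
    \<comment> \<open>Applying T minus the last eigenvalue removes the last term of the relation and
      multiplies each other coefficient by a nonzero difference of eigenvalues.\<close>
    have "(\<Sum>i\<le>n. scale (c i * (\<mu> i - \<mu> (Suc n))) (x i))
        = (\<Sum>i\<le>Suc n. scale (c i * (\<mu> i - \<mu> (Suc n))) (x i))"
      by simp
    also have "\<dots> = (\<Sum>i\<le>Suc n. scale (c i * \<mu> i) (x i)) - (\<Sum>i\<le>Suc n. scale (\<mu> (Suc n) * c i) (x i))"
      unfolding sum_subtractf[symmetric]
      by (intro sum.cong refl) (metis mult.commute right_diff_distrib scale_left_diff_distrib)
    also have "\<dots> = T ?s - scale (\<mu> (Suc n)) ?s"
      unfolding T.sum T.scale eig scale_sum_right by (simp del: sum.atMost_Suc)
    also have "\<dots> = 0" using Suc.prems by (simp only: T.zero scale_zero_right diff_self)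
    finally have "\<forall>i\<le>n. c i * (\<mu> i - \<mu> (Suc n)) = 0"
      by (rule Suc.IH)
    then have *: "\<forall>i\<le>n. c i = 0"
      using inj by (force simp: inj_def)
    then have "scale (c (Suc n)) (x (Suc n)) = 0"
      using Suc.prems by simp
    with * nz show ?case by (auto simp: le_Suc_eq)
  qed
  obtain n c i where "i \<le> n" "c i \<noteq> 0" "(\<Sum>i\<le>n. scale (c i) (x i)) = 0"
    by (rule infinite_sequence_dependent)
  with indep show False by blast
qed

text \<open>A basis of the kernel inside X together with chosen preimages of a basis of T(X) is a
  basis of X. T(X) may lie outside X, as is the case when E shifts weight spaces.\<close>

lemma rank_nullity_subspace:
  assumes T: "Vector_Spaces.linear scale scale T" and X: "subspace X"
  shows "dim X = dim {v\<in>X. T v = 0} + dim (T ` X)"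
proof -
  interpret T: Vector_Spaces.linear scale scale T by fact
  let ?K = "{v\<in>X. T v = 0}"
  have K: "subspace ?K"
    using X by (auto simp: subspace_def T.add T.scale T.zero)
  obtain A where A: "A \<subseteq> ?K" "independent A" "?K \<subseteq> span A" "card A = dim ?K"
    using basis_exists[of ?K] by auto
  obtain C where C: "C \<subseteq> T ` X" "independent C" "T ` X \<subseteq> span C" "card C = dim (T ` X)"
    using basis_exists[of "T ` X"] by auto
  define g where "g = inv_into X T"
  have g: "g c \<in> X" "T (g c) = c" if "c \<in> C" for c
    using C(1) that by (auto simp: g_def inv_into_into f_inv_into_f)
  have fin: "finite A" "finite C"
    using A C finiteI_independent by auto
  have injg: "inj_on g C"
    by (rule inj_on_inverseI[of _ T]) (simp add: g)
  have disj: "A \<inter> g ` C = {}"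
  proof -
    have "0 \<notin> C" using C(2) dependent_zero by blast
    then show ?thesis using A(1) g by force
  qed
  have "independent (A \<union> g ` C)"
  proof (rule independent_if_scalars_zero)
    fix f x assume sum0: "(\<Sum>x\<in>A \<union> g ` C. scale (f x) x) = 0" and x: "x \<in> A \<union> g ` C"
    have split: "(\<Sum>x\<in>A. scale (f x) x) + (\<Sum>c\<in>C. scale (f (g c)) (g c)) = 0"
      using sum0 fin disj injg by (simp add: sum.union_disjoint sum.reindex)
    have "(\<Sum>x\<in>A. scale (f x) (T x)) = 0"
      using A(1) by (intro sum.neutral) auto
    moreover have "T ((\<Sum>x\<in>A. scale (f x) x) + (\<Sum>c\<in>C. scale (f (g c)) (g c))) = 0"
      using split T.zero by simp
    ultimately have "(\<Sum>c\<in>C. scale (f (g c)) c) = 0"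
      by (simp add: T.add T.sum T.scale g)
    then have C0: "\<forall>c\<in>C. f (g c) = 0"
      using C(2) by (auto simp: dependent_finite fin)
    then have "(\<Sum>x\<in>A. scale (f x) x) = 0"
      using split by simp
    then have "\<forall>a\<in>A. f a = 0"
      using A(2) by (auto simp: dependent_finite fin)
    with C0 x show "f x = 0" by auto
  qed (use fin in auto)
  moreover have "X \<subseteq> span (A \<union> g ` C)"
  proof
    fix x assume x: "x \<in> X"
    then have "T x \<in> span C" using C(3) by auto
    then obtain u where u: "T x = (\<Sum>c\<in>C. scale (u c) c)"
      using fin by (auto simp: span_finite)
    define y where "y = (\<Sum>c\<in>C. scale (u c) (g c))"
    have y: "y \<in> span (g ` C)" "y \<in> X"
      unfolding y_def using g X by (auto intro: span_sum span_scale subspace_sum subspace_scale span_base)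
    have "T y = T x"
      by (simp add: u y_def T.sum T.scale g)
    then have "x - y \<in> span A"
      using A(3) x y X by (auto simp: T.diff subspace_diff)
    then have "x - y + y \<in> span (A \<union> g ` C)"
      using y(1) by (intro span_add) (meson Un_upper1 Un_upper2 span_mono subsetD)+
    then show "x \<in> span (A \<union> g ` C)" by simp
  qed
  moreover have "A \<union> g ` C \<subseteq> X"
    using A(1) g by auto
  ultimately have "dim X = card (A \<union> g ` C)"
    by (metis basis_card_eq_dim)
  also have "\<dots> = dim ?K + dim (T ` X)"
    using A(4) C(4) fin disj injg by (simp add: card_Un_disjoint card_image)
  finally show ?thesis .
qed

end

locale complex_fd_space = finite_dimensional_vector_space scale Basis
  for scale :: "complex \<Rightarrow> 'v::ab_group_add \<Rightarrow> 'v" and Basis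
begin

text \<open>A product of factors \<open>T - a\<close> annihilates any vector; this is the induction over its factors.\<close>

lemma operator_induct [consumes 1, case_names zero step]:
  assumes T: "Vector_Spaces.linear scale scale T"
    and zero: "P 0"
    and step: "\<And>v a. P (T v - scale a v) \<Longrightarrow> P v"
  shows "P v"
proof -
  interpret T: Vector_Spaces.linear scale scale T by fact
  \<comment> \<open>\<open>ap n p v\<close> is p(T) v with the sum cut at \<open>n\<close>, which
    loses nothing when the degree of p is at most \<open>n\<close>.\<close>
  define ap where "ap = (\<lambda>n p v. \<Sum>i\<le>n. scale (coeff p i) ((T ^^ i) v))"
  have *: "P v" if "p \<noteq> 0" "degree p = n" "ap n p v = 0" for n p v
    using that
  proof (induction n arbitrary: p v)
    case 0
    then have "v = 0"
      by (auto simp: ap_def elim!: degree_eq_zeroE)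
    with zero show ?case by simp
  next
    case (Suc n)
    \<comment> \<open>Over the complex numbers p has a root a. Writing p = (X - a) q gives p(T) v =
      q(T) (T v - a v), where q has degree one less.\<close>
    then have "\<not> constant (poly p)"
      by (simp add: constant_degree)
    then obtain a where "poly p a = 0"
      using fundamental_theorem_of_algebra by blast
    then obtain q where q: "p = [:-a, 1:] * q"
      by (auto simp: poly_eq_0_iff_dvd dvd_def)
    with Suc.prems have q0: "q \<noteq> 0" by auto
    then have dq: "degree q = n"
      using Suc.prems(2) by (simp add: q degree_mult_eq del: mult_pCons_left)
    have lin: "(T ^^ i) (x - scale c y) = (T ^^ i) x - scale c ((T ^^ i) y)" for i c x y
      by (induction i) (simp_all add: T.diff T.scale)
    have "ap (Suc n) p v
        = (\<Sum>i\<le>Suc n. scale (coeff (pCons 0 q) i) ((T ^^ i) v))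
          - (\<Sum>i\<le>Suc n. scale (a * coeff q i) ((T ^^ i) v))"
      unfolding ap_def sum_subtractf[symmetric] q
      by (intro sum.cong refl) (simp add: scale_left_diff_distrib[symmetric])
    also have "(\<Sum>i\<le>Suc n. scale (coeff (pCons 0 q) i) ((T ^^ i) v))
        = (\<Sum>i\<le>n. scale (coeff q i) ((T ^^ i) (T v)))"
      by (subst sum.atMost_Suc_shift) (simp add: funpow_swap1)
    also have "(\<Sum>i\<le>Suc n. scale (a * coeff q i) ((T ^^ i) v))
        = (\<Sum>i\<le>n. scale (a * coeff q i) ((T ^^ i) v))"
      by (simp add: coeff_eq_0 dq)
    also have "(\<Sum>i\<le>n. scale (coeff q i) ((T ^^ i) (T v))) - \<dots> = ap n q (T v - scale a v)"
      by (simp add: ap_def lin scale_right_diff_distrib mult.commute flip: sum_subtractf)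
    finally have "P (T v - scale a v)"
      using Suc.IH[OF q0 dq] Suc.prems(3) by simp
    then show ?case by (rule step)
  qed
  obtain n c i where c: "i \<le> n" "c i \<noteq> 0" "(\<Sum>i\<le>n. scale (c i) ((T ^^ i) v)) = 0"
    by (rule infinite_sequence_dependent)
  define p where "p = (\<Sum>j\<le>n. monom (c j) j)"
  have co: "coeff p j = (if j \<le> n then c j else 0)" for j
    by (simp add: p_def coeff_sum)
  have "p \<noteq> 0" using c co[of i] by auto
  moreover have "degree p \<le> n" by (rule degree_le) (simp add: co)
  then have "ap (degree p) p v = ap n p v"
    unfolding ap_def by (intro sum.mono_neutral_left) (auto simp: coeff_eq_0)
  then have "ap (degree p) p v = 0"
    using c(3) by (simp add: ap_def co)
  ultimately show ?thesis using * by blast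
qed

text \<open>The hypothesis \<open>semisimple\<close> excludes Jordan blocks of size two on S, which
  forces T to be diagonalisable there. If T v - a v is already a combination of eigenvectors, it
  equals T y - a y + w with w in the kernel of T - a; then v - y falls under the hypothesis and is
  an eigenvector.\<close>

lemma span_eigenvectors:
  assumes T: "Vector_Spaces.linear scale scale T"
    and S: "subspace S" "\<And>v. v \<in> S \<Longrightarrow> T v \<in> S"
    and semisimple: "\<And>v w a. \<lbrakk>v \<in> S; T v = scale a v + w; T w = scale a w\<rbrakk> \<Longrightarrow> w = 0"
    and v: "v \<in> S"
  shows "v \<in> span {x \<in> S. \<exists>a. T x = scale a x}" (is "_ \<in> span ?X")
proof -
  interpret T: Vector_Spaces.linear scale scale T by fact
  \<comment> \<open>An eigenvector x for b different from a is the image of x / (b - a) under T - a;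
    one for a itself is absorbed into w.\<close>
  have *: "\<exists>y\<in>span ?X. \<exists>w. u = T y - scale a y + w \<and> T w = scale a w" if "u \<in> span ?X" for u a
    using that
  proof (induction u rule: span_induct_alt)
    case base
    then show ?case using span_zero by (intro bexI[of _ 0] exI[of _ 0]) (auto simp: T.zero)
  next
    case (step c x u)
    then obtain b y w where b: "T x = scale b x" and y: "y \<in> span ?X" "u = T y - scale a y + w"
        "T w = scale a w" by auto
    show ?case
    proof (cases "b = a")
      case True
      then show ?thesis using y b
        by (intro bexI[of _ y] exI[of _ "w + scale c x"])
          (auto simp: T.add T.scale scale_right_distrib algebra_simps)
    next
      case False
      let ?y = "y + scale (c / (b - a)) x"
      have "T ?y - scale a ?y = T y - scale a y + scale (c / (b - a) * (b - a)) x"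
        unfolding right_diff_distrib scale_left_diff_distrib
        by (simp add: T.add T.scale b scale_right_distrib mult.commute)
      then have "scale c x + u = T ?y - scale a ?y + w"
        using False y by simp
      moreover have "?y \<in> span ?X"
        using y step.hyps by (auto intro: span_add span_scale span_base)
      ultimately show ?thesis using y(3) by blast
    qed
  qed
  have sub: "span ?X \<subseteq> S"
    using S(1) by (intro span_minimal) auto
  have "v \<in> S \<longrightarrow> v \<in> span ?X"
    using T
  proof (induction v rule: operator_induct)
    case zero
    then show ?case by (simp add: span_zero)
  next
    case (step v a)
    show ?case
    proof
      assume v: "v \<in> S"
      then have "T v - scale a v \<in> span ?X"
        using step S subspace_diff subspace_scale by auto
      then obtain y w where y: "y \<in> span ?X" "T v - scale a v = T y - scale a y + w" "T w = scale a w"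
        using * by blast
      have vy: "v - y \<in> S" using v y sub S(1) by (auto intro: subspace_diff)
      have Tvy: "T (v - y) = scale a (v - y) + w"
        using y(2) by (simp add: T.diff scale_right_diff_distrib algebra_simps)
      then have "w = 0" using semisimple vy y(3) by blast
      then have "v - y \<in> ?X" using vy Tvy by auto
      then show "v \<in> span ?X" using span_add[OF span_base y(1)] by fastforce
    qed
  qed
  with v show ?thesis by blast
qed

end

section \<open>Highest weight theory of a single triple\<close>

locale sl2_triple = complex_fd_space scale Basis +
  E: Vector_Spaces.linear scale scale E + F: Vector_Spaces.linear scale scale F +
  H: Vector_Spaces.linear scale scale H
  for scale :: "complex \<Rightarrow> 'v::ab_group_add \<Rightarrow> 'v" and Basis
    and E F H :: "'v \<Rightarrow> 'v" +
  assumes HE: "H (E v) = E (H v) + scale 2 (E v)"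
    and HF: "H (F v) = F (H v) - scale 2 (F v)"
    and EF: "E (F v) = F (E v) + H v"
begin

definition stable :: "'v set \<Rightarrow> bool" where
  "stable S \<longleftrightarrow> subspace S \<and> (\<forall>v\<in>S. E v \<in> S \<and> F v \<in> S \<and> H v \<in> S)"

text \<open>This symmetry turns every result on raising into one on lowering, with weights
  negated.\<close>

lemma sl2_triple_swap: "sl2_triple scale Basis F E (\<lambda>v. - H v)"
proof -
  have "Vector_Spaces.linear scale scale (\<lambda>v. - H v)"
    by unfold_locales (auto simp: H.add H.scale)
  then interpret nH: Vector_Spaces.linear scale scale "\<lambda>v. - H v" .
  show ?thesis
    by unfold_locales (auto simp: HE HF EF E.neg F.neg)
qed

lemma stable_funpow:
  assumes "stable S" "v \<in> S"
  shows "(E ^^ k) v \<in> S" "(F ^^ k) v \<in> S"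
  by (induction k) (use assms in \<open>auto simp: stable_def\<close>)

section \<open>Commutation formulas for powers of E and F\<close>

lemma funpow_diff_scale:
  "(F ^^ k) (v - scale c w) = (F ^^ k) v - scale c ((F ^^ k) w)"
  "(F ^^ k) (v + w) = (F ^^ k) v + (F ^^ k) w"
  "(F ^^ k) (scale c w) = scale c ((F ^^ k) w)"
  "(F ^^ k) 0 = 0"
  by (induction k) (simp_all add: F.diff F.scale F.add F.zero)

lemma H_E_funpow: "H ((E ^^ k) v) = (E ^^ k) (H v) + scale (2 * of_nat k) ((E ^^ k) v)"
proof (induction k)
  case (Suc k)
  then show ?case
    by (simp add: HE E.add E.scale scale_left_distrib algebra_simps)
qed simp

lemma H_F_funpow: "H ((F ^^ k) v) = (F ^^ k) (H v) - scale (2 * of_nat k) ((F ^^ k) v)"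
proof (induction k)
  case (Suc k)
  then show ?case
    by (simp add: HF F.diff F.scale scale_left_distrib distrib_left)
qed simp

text \<open>Here v is arbitrary rather than a weight vector, so that the formula also applies to the
  generalised weight vectors in the proof that H is semisimple.\<close>

lemma E_F_funpow:
  "E ((F ^^ Suc k) v) = (F ^^ Suc k) (E v) + scale (of_nat (Suc k)) ((F ^^ k) (H v - scale (of_nat k) v))"
proof (induction k)
  case (Suc k)
  have "E ((F ^^ Suc (Suc k)) v) = F (E ((F ^^ Suc k) v)) + H ((F ^^ Suc k) v)"
    using EF by simp
  also have "F (E ((F ^^ Suc k) v)) = (F ^^ Suc (Suc k)) (E v)
      + scale (of_nat (Suc k)) ((F ^^ Suc k) (H v) - scale (of_nat k) ((F ^^ Suc k) v))"
    unfolding Suc.IH by (simp add: F.add F.diff F.scale funpow_diff_scale)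
  also have "H ((F ^^ Suc k) v) = (F ^^ Suc k) (H v) - scale (2 * of_nat (Suc k)) ((F ^^ Suc k) v)"
    by (rule H_F_funpow)
  finally have "E ((F ^^ Suc (Suc k)) v) = (F ^^ Suc (Suc k)) (E v)
      + (scale (of_nat (Suc k)) ((F ^^ Suc k) (H v) - scale (of_nat k) ((F ^^ Suc k) v))
      + ((F ^^ Suc k) (H v) - scale (2 * of_nat (Suc k)) ((F ^^ Suc k) v)))"
    by (simp add: add.assoc)
  moreover have "scale a (x - scale b y) + (x - scale (2 * a) y) = scale (a + 1) (x - scale (b + 1) y)"
    if "a = b + 1" for a b x y
  proof -
    have "scale a (x - scale b y) + (x - scale (2 * a) y)
       = scale (a + 1) x - scale (a * b + 2 * a) y"
      by (simp add: scale_right_diff_distrib scale_left_distrib)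
    also have "a * b + 2 * a = (a + 1) * (b + 1)"
      by (simp add: that algebra_simps)
    finally show ?thesis by (simp add: scale_right_diff_distrib)
  qed
  note this[of "of_nat (Suc k)" "of_nat k" "(F ^^ Suc k) (H v)" "(F ^^ Suc k) v"]
  ultimately show ?case
    unfolding funpow_diff_scale by (simp add: add.commute)
qed (simp add: EF)

lemma E_F_funpow_weight:
  assumes "H v = scale c v"
  shows "E ((F ^^ Suc k) v)
    = (F ^^ Suc k) (E v) + scale (of_nat (Suc k) * (c - of_nat k)) ((F ^^ k) v)"
  unfolding E_F_funpow by (simp add: assms funpow_diff_scale scale_left_diff_distrib[symmetric])

lemma H_E_funpow_weight:
  assumes "H v = scale c v"
  shows "H ((E ^^ k) v) = scale (c + 2 * of_nat k) ((E ^^ k) v)"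
proof -
  have "(E ^^ k) (scale c v) = scale c ((E ^^ k) v)"
    by (induction k) (simp_all add: E.scale)
  then show ?thesis
    by (simp add: H_E_funpow assms scale_left_distrib)
qed

text \<open>The vectors E^k v are eigenvectors of H, if nonzero, with pairwise distinct eigenvalues
  c + 2k, so one of them vanishes.\<close>

lemma weight_E_nilpotent:
  assumes "H v = scale c v"
  shows "\<exists>k. (E ^^ k) v = 0"
proof (rule eigenvectors_vanish)
  show "Vector_Spaces.linear scale scale H" by unfold_locales
  show "H ((E ^^ k) v) = scale (c + 2 * of_nat k) ((E ^^ k) v)" for k
    using H_E_funpow_weight[OF assms, of k] by simp
  show "inj (\<lambda>k. c + 2 * of_nat k)" by (auto simp: inj_def)
qed

lemma weight_F_nilpotent:
  assumes "H v = scale c v"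
  shows "\<exists>k. (F ^^ k) v = 0"
proof -
  interpret swap: sl2_triple scale Basis F E "\<lambda>v. - H v" by (rule sl2_triple_swap)
  show ?thesis
    using swap.weight_E_nilpotent[of v "-c"] assms by simp
qed

lemma F_funpow_zero_mono: "(F ^^ j) v = 0 \<Longrightarrow> j \<le> k \<Longrightarrow> (F ^^ k) v = 0"
  by (induction k) (auto simp: le_Suc_eq F.zero)

text \<open>If F^(n+1) v is the first power that vanishes, then 0 = E F^(n+1) v = (n + 1) (c - n)
  F^n v forces c = n.\<close>

lemma highest_weight_natural:
  assumes "v \<noteq> 0" "E v = 0" "H v = scale c v"
  obtains n :: nat where "c = of_nat n" "(F ^^ Suc n) v = 0" "\<And>k. k \<le> n \<Longrightarrow> (F ^^ k) v \<noteq> 0"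
proof -
  define m where "m = (LEAST k. (F ^^ k) v = 0)"
  have m: "(F ^^ m) v = 0" "\<And>k. k < m \<Longrightarrow> (F ^^ k) v \<noteq> 0"
    unfolding m_def using weight_F_nilpotent[OF assms(3)] by (auto intro: LeastI_ex dest: not_less_Least)
  with assms(1) obtain n where n: "m = Suc n" by (cases m) auto
  have "scale (of_nat (Suc n) * (c - of_nat n)) ((F ^^ n) v) = 0"
    using E_F_funpow_weight[OF assms(3), of n] m(1) assms(2)
    unfolding n by (simp add: funpow_diff_scale E.zero del: funpow.simps)
  moreover have "(F ^^ n) v \<noteq> 0" using m(2) n by blast
  ultimately have "c = of_nat n" by (simp del: of_nat_Suc)
  with m n that show thesis by (metis less_Suc_eq_le)
qed

lemma E_F_funpow_highest:
  assumes "E v = 0" "H v = scale (of_nat n) v"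
  shows "E ((F ^^ k) v) = scale (of_nat k * (of_nat n - of_nat k + 1)) ((F ^^ (k - 1)) v)"
proof (cases k)
  case (Suc j)
  then show ?thesis
    using E_F_funpow_weight[OF assms(2), of j] assms(1)
    by (simp add: funpow_diff_scale F.zero)
qed (simp add: assms)

text \<open>
  Since \<open>E F\<^sup>k\<^sup>+\<^sup>1 E\<^sup>k w = F\<^sup>k\<^sup>+\<^sup>1 E\<^sup>k\<^sup>+\<^sup>1 w + (k + 1) (n + k) F\<^sup>k E\<^sup>k w\<close>, a preimage of \<open>F\<^sup>k E\<^sup>k w\<close>
  is obtained from one of \<open>F\<^sup>k\<^sup>+\<^sup>1 E\<^sup>k\<^sup>+\<^sup>1 w\<close>.
\<close>

lemma E_preimage:
  assumes w: "H w = scale (of_nat n) w" and n: "n > 0"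
    and Q: "subspace Q" "\<And>k. (F ^^ Suc k) ((E ^^ k) w) \<in> Q"
  obtains u where "u \<in> Q" "E u = w" "H u = scale (of_nat n - 2) u"
proof -
  obtain K where K: "(E ^^ K) w = 0"
    using weight_E_nilpotent[OF w] by blast
  let ?x = "\<lambda>k. (F ^^ k) ((E ^^ k) w)"
  have wt: "H ((E ^^ k) w) = scale (of_nat (n + 2 * k)) ((E ^^ k) w)" for k
    using H_E_funpow_weight[OF w, of k] by simp
  \<comment> \<open>The induction runs downwards from the exponent K, where E^K w = 0 and u = 0 is a
    preimage, to exponent 0, where the vector is w itself.\<close>
  have "\<exists>u\<in>Q. E u = ?x (K - j) \<and> H u = scale (of_nat n - 2) u" if "j \<le> K" for j
    using that
  proof (induction j)
    case 0
    then show ?case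
      using Q(1) by (intro bexI[of _ 0]) (auto simp: K E.zero H.zero funpow_diff_scale subspace_0)
  next
    case (Suc j)
    define k where "k = K - Suc j"
    have k: "K - j = Suc k" using Suc.prems by (simp add: k_def)
    obtain u where u: "u \<in> Q" "E u = ?x (Suc k)" "H u = scale (of_nat n - 2) u"
      using Suc unfolding k by auto
    let ?d = "of_nat (Suc k) * of_nat (n + k) :: complex"
    let ?y = "(F ^^ Suc k) ((E ^^ k) w)"
    have d: "?d \<noteq> 0" using n by (simp del: of_nat_Suc of_nat_add)
    have "E ?y = ?x (Suc k) + scale ?d (?x k)"
      using E_F_funpow_weight[OF wt, of k k] by (simp add: algebra_simps)
    then have "E (scale (inverse ?d) (?y - u)) = ?x k"
      using left_inverse[OF d]
      by (simp only: E.scale E.diff u(2) add_diff_cancel_left' scale_scale scale_one)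
    moreover have "H ?y = scale (of_nat n - 2) ?y"
      unfolding H_F_funpow wt funpow_diff_scale scale_left_diff_distrib[symmetric]
      by (simp add: algebra_simps)
    then have "H (scale (inverse ?d) (?y - u)) = scale (of_nat n - 2) (scale (inverse ?d) (?y - u))"
      by (simp add: H.scale H.diff u(3) scale_right_diff_distrib mult.commute)
    moreover have "scale (inverse ?d) (?y - u) \<in> Q"
      using Q u by (intro subspace_scale subspace_diff)
    ultimately show ?case unfolding k_def[symmetric] by blast
  qed
  from this[of K] that show thesis by auto
qed

text \<open>
  If \<open>w \<noteq> 0\<close>, then \<open>E F\<^sup>n\<^sup>+\<^sup>1 v = (n + 1) F\<^sup>n w \<noteq> 0\<close>, while for \<open>k > n\<close> the vector \<open>F\<^sup>k v\<close> is a weight vector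
  and \<open>E F\<^sup>k\<^sup>+\<^sup>1 v\<close> is a nonzero multiple of it. So no \<open>F\<^sup>k v\<close> vanishes, contradicting nilpotency of \<open>F\<close>.
\<close>

lemma H_semisimple_on_kernel:
  assumes "E v = 0" "H v = scale (of_nat n) v + w" "H w = scale (of_nat n) w"
  shows "w = 0"
proof (rule ccontr)
  assume w: "w \<noteq> 0"
  have Ew: "E w = 0"
  proof -
    have "E w = E (H v) - scale (of_nat n) (E v)" by (simp add: assms(2) E.add E.scale)
    also have "\<dots> = 0" using HE[of v] by (simp add: assms(1) H.zero)
    finally show ?thesis .
  qed
  obtain n' :: nat where "of_nat n = (of_nat n' :: complex)" and
    n': "(F ^^ Suc n') w = 0" "\<And>k. k \<le> n' \<Longrightarrow> (F ^^ k) w \<noteq> 0"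
    using highest_weight_natural[OF w Ew assms(3)] by metis
  then have [simp]: "n' = n" by simp
  have step: "E ((F ^^ Suc k) v)
      = scale (of_nat (Suc k)) (scale (of_nat n - of_nat k) ((F ^^ k) v) + (F ^^ k) w)" for k
    unfolding E_F_funpow assms funpow_diff_scale by (simp add: scale_left_diff_distrib F.zero funpow_diff_scale)
  let ?y = "(F ^^ Suc n) v"
  have "H ?y = scale (of_nat n - 2 * of_nat (Suc n)) ?y"
    unfolding H_F_funpow assms funpow_diff_scale scale_left_diff_distrib
    using n' by simp
  then obtain j where "(F ^^ j) ?y = 0" using weight_F_nilpotent by blast
  then have "(F ^^ (Suc n + j)) v = 0" by (simp add: funpow_add add.commute[of n] funpow_swap1)
  then have "?y = 0"
  proof (induction j)
    case (Suc j)
    have "(F ^^ (Suc n + j)) w = 0" by (rule F_funpow_zero_mono[OF n'(1)]) simp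
    then have "scale (of_nat (Suc (Suc n + j)) * (of_nat n - of_nat (Suc n + j))) ((F ^^ (Suc n + j)) v) = 0"
      using step[of "Suc n + j"] Suc.prems by (simp add: E.zero del: of_nat_Suc of_nat_add)
    moreover have "(of_nat n - of_nat (Suc n + j) :: complex) \<noteq> 0"
      by (metis add_Suc eq_iff_diff_eq_0 less_add_Suc1 less_irrefl of_nat_eq_iff)
    ultimately have "(F ^^ (Suc n + j)) v = 0" by (simp del: of_nat_Suc of_nat_add)
    then show ?case by (rule Suc.IH)
  qed simp
  then have "scale (of_nat (Suc n)) ((F ^^ n) w) = 0"
    using step[of n] by (simp add: E.zero del: of_nat_Suc)
  with n'(2)[of n] show False by (simp del: of_nat_Suc)
qed

text \<open>Induct on a power of E that kills v. The pair E v, E w satisfies the same equations with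
  c + 2, so E w = 0; if w were nonzero, c would be a natural number. Then E v has a preimage u of
  weight c, and v - u lies in the kernel of E, where \<open>H_semisimple_on_kernel\<close>
  applies.\<close>

lemma H_semisimple:
  assumes "H v = scale c v + w" "H w = scale c w"
  shows "w = 0"
proof -
  obtain k where k: "(E ^^ k) w = 0"
    using weight_E_nilpotent[OF assms(2)] by blast
  \<comment> \<open>Since E^k kills w, E^k v satisfies the true weight equation and is killed by a
    further power of E. This supplies the power from which the induction starts.\<close>
  have "H ((E ^^ k) v) = scale (c + 2 * of_nat k) ((E ^^ k) v)"
  proof -
    have "(E ^^ k) (scale c v + w) = scale c ((E ^^ k) v) + (E ^^ k) w" for k
      by (induction k) (simp_all add: E.add E.scale)
    then show ?thesis unfolding H_E_funpow assms k by (simp add: k scale_left_distrib)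
  qed
  then obtain j where "(E ^^ j) ((E ^^ k) v) = 0"
    using weight_E_nilpotent by blast
  then have "(E ^^ (j + k)) v = 0" by (simp add: funpow_add)
  moreover have "w = 0" if "(E ^^ m) v = 0" "H v = scale c v + w" "H w = scale c w" for m v c w
    using that
  proof (induction m arbitrary: v c w)
    case 0
    then show ?case by (simp add: H.zero)
  next
    case (Suc m)
    have HEv: "H (E v) = scale (c + 2) (E v) + E w"
      unfolding HE Suc.prems by (simp add: E.add E.scale scale_left_distrib)
    have HEw: "H (E w) = scale (c + 2) (E w)"
      unfolding HE Suc.prems by (simp add: E.add E.scale scale_left_distrib)
    have Ew: "E w = 0"
      using Suc.IH[OF _ HEv HEw] Suc.prems(1) by (simp add: funpow_swap1)
    show ?case
    proof (rule ccontr)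
      assume w: "w \<noteq> 0"
      obtain n :: nat where n: "c = of_nat n"
        using highest_weight_natural[OF w Ew Suc.prems(3)] by metis
      have "H (E v) = scale (of_nat (n + 2)) (E v)"
        using HEv by (simp add: Ew n)
      then obtain u where u: "E u = E v" "H u = scale (of_nat n) u"
        by (rule E_preimage[of _ _ UNIV]) (auto simp: subspace_UNIV)
      have "w = 0"
      proof (rule H_semisimple_on_kernel)
        show "E (v - u) = 0" by (simp add: E.diff u)
        show "H (v - u) = scale (of_nat n) (v - u) + w"
          using Suc.prems(2) by (simp add: H.diff u n scale_right_diff_distrib)
        show "H w = scale (of_nat n) w" using Suc.prems(3) n by simp
      qed
      with w show False ..
    qed
  qed
  ultimately show ?thesis using assms by blast
qed

lemma stable_eq_span_weights:
  assumes "stable S" "v \<in> S"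
  shows "v \<in> span {x \<in> S. \<exists>c. H x = scale c x}"
proof (rule span_eigenvectors)
  show "Vector_Spaces.linear scale scale H" by unfold_locales
qed (use assms H_semisimple in \<open>auto simp: stable_def\<close>)

text \<open>The last nonzero vector among the E^k v has a natural weight, and it differs from the
  weight of v by 2k.\<close>

lemma weight_integral:
  assumes "H v = scale c v" "v \<noteq> 0"
  obtains k :: int where "c = of_int k"
proof -
  define m where "m = (LEAST k. (E ^^ k) v = 0)"
  have m: "(E ^^ m) v = 0" "\<And>k. k < m \<Longrightarrow> (E ^^ k) v \<noteq> 0"
    unfolding m_def using weight_E_nilpotent[OF assms(1)] by (auto intro: LeastI_ex dest: not_less_Least)
  with assms obtain k where k: "m = Suc k" by (cases m) auto
  have "H ((E ^^ k) v) = scale (c + 2 * of_nat k) ((E ^^ k) v)"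
    using H_E_funpow_weight[OF assms(1), of k] by simp
  then obtain n :: nat where "c + 2 * of_nat k = of_nat n"
    using highest_weight_natural[of "(E ^^ k) v"] m k by (metis funpow.simps(2) lessI o_apply)
  then have "c = of_int (int n - 2 * int k)" by (simp add: algebra_simps)
  with that show thesis by blast
qed

text \<open>The claim that S is generated by highest weight vectors under F, put as a containment so
  that it can be applied to the three copies in turn. A vector of natural weight differs from a
  highest weight vector by an explicit preimage in Q; a vector of negative weight is F of one whose
  weight is larger by 2.\<close>

lemma stable_subset_if_highest_weight_vectors:
  assumes S: "stable S" and Q: "subspace Q" "\<And>v. v \<in> Q \<Longrightarrow> F v \<in> Q"
    and hw: "\<And>v n. \<lbrakk>v \<in> S; E v = 0; H v = scale (of_nat (n::nat)) v\<rbrakk> \<Longrightarrow> v \<in> Q"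
  shows "S \<subseteq> Q"
proof -
  have FQ: "(F ^^ k) v \<in> Q" if "v \<in> Q" for k v
    by (induction k) (use that Q in auto)
  have nonneg: "v \<in> Q" if "(E ^^ m) v = 0" "v \<in> S" "H v = scale (of_nat n) v" for m n v
    using that
  proof (induction m arbitrary: v n)
    case 0
    then show ?case using subspace_0[OF Q(1)] by simp
  next
    case (Suc m)
    let ?w = "E v"
    have w: "H ?w = scale (of_nat (n + 2)) ?w"
      unfolding HE Suc.prems by (simp add: E.scale scale_left_distrib)
    have wS: "?w \<in> S" using S Suc.prems by (auto simp: stable_def)
    have "?w \<in> Q"
      by (rule Suc.IH[OF _ wS w]) (use Suc.prems in \<open>simp add: funpow_swap1\<close>)
    \<comment> \<open>All E^k E v are killed by E^m, so the induction hypothesis puts them in Q.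
      Hence the vectors F^(k+1) E^k E v, from which the preimage of E v is built, lie in Q as
      well.\<close>
    have wk: "(E ^^ k) ?w \<in> Q" for k
    proof (rule Suc.IH)
      have "(E ^^ m) ((E ^^ k) ?w) = (E ^^ k) ((E ^^ Suc m) v)"
        by (metis (no_types, lifting) add.commute comp_apply funpow_Suc_right funpow_add)
      also have "\<dots> = (E ^^ k) 0" by (simp only: Suc.prems(1))
      also have "\<dots> = 0" by (induction k) (simp_all add: E.zero)
      finally show "(E ^^ m) ((E ^^ k) ?w) = 0" .
      show "H ((E ^^ k) ?w) = scale (of_nat (n + 2 + 2 * k)) ((E ^^ k) ?w)"
        using H_E_funpow_weight[OF w, of k] by simp
    qed (use stable_funpow(1)[OF S wS] in simp)
    obtain u where u: "u \<in> S \<inter> Q" "E u = E v" "H u = scale (of_nat (n + 2) - 2) u"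
    proof (rule E_preimage[OF w])
      show "subspace (S \<inter> Q)" using S Q by (simp add: stable_def subspace_inter)
      show "(F ^^ Suc k) ((E ^^ k) ?w) \<in> S \<inter> Q" for k
        using FQ[OF wk] stable_funpow(2)[OF S stable_funpow(1)[OF S wS]] by blast
    qed auto
    have "v - u \<in> Q"
    proof (rule hw)
      show "v - u \<in> S" using S Suc.prems u by (auto simp: stable_def intro: subspace_diff)
      show "E (v - u) = 0" by (simp add: E.diff u)
      show "H (v - u) = scale (of_nat n) (v - u)"
        by (simp add: H.diff u Suc.prems scale_right_diff_distrib)
    qed
    then have "v - u + u \<in> Q" using u Q by (intro subspace_add) auto
    then show ?case by simp
  qed
  interpret swap: sl2_triple scale Basis F E "\<lambda>v. - H v" by (rule sl2_triple_swap)
  \<comment> \<open>The lower bound on the weight drops by one at each induction step. The swapped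
    triple sees the weight -k > 0, so its preimage lemma yields u with F u = v and weight k +
    2.\<close>
  have neg: "v \<in> Q" if "v \<in> S" "H v = scale (of_int k) v" "k > - int m" for v k m
    using that
  proof (induction m arbitrary: v k)
    case 0
    then show ?case using nonneg[of _ v "nat k"] weight_E_nilpotent[OF 0(2)] by auto
  next
    case (Suc m)
    show ?case
    proof (cases "k \<ge> 0")
      case True
      then show ?thesis
        using nonneg[of _ v "nat k"] weight_E_nilpotent[OF Suc.prems(2)] Suc.prems by auto
    next
      case False
      have "- H v = scale (of_nat (nat (- k))) v"
        using Suc.prems False by simp
      then obtain u where u: "u \<in> S" "F u = v" "- H u = scale (of_nat (nat (- k)) - 2) u"
        by (rule swap.E_preimage[of _ _ S])
          (use False S Suc.prems in \<open>auto simp: stable_def intro: stable_funpow[OF S, simplified]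
            simp del: funpow.simps\<close>)
      have "H u = scale (of_int (k + 2)) u"
        using u(3) False by (simp add: minus_equation_iff[of "H u"] scale_left_distrib algebra_simps)
      then have "u \<in> Q" by (rule Suc.IH[OF u(1)]) (use Suc.prems(3) in simp)
      then show ?thesis using Q(2) u(2) by auto
    qed
  qed
  have "{x \<in> S. \<exists>c. H x = scale c x} \<subseteq> Q"
  proof clarify
    fix x c assume x: "x \<in> S" "H x = scale c x"
    show "x \<in> Q"
    proof (cases "x = 0")
      case False
      then obtain k :: int where "c = of_int k" using weight_integral x by blast
      then show ?thesis using neg[of x k "nat (1 - k)"] x by auto
    qed (use Q in \<open>simp add: subspace_0\<close>)
  qed
  then have "span {x \<in> S. \<exists>c. H x = scale c x} \<subseteq> Q"
    using Q(1) by (rule span_minimal)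
  then show ?thesis using stable_eq_span_weights[OF S] by blast
qed

text \<open>Inside S, E maps weight n onto weight n + 2: the target weight is positive, so
  \<open>E_preimage\<close> provides preimages. The rest is rank-nullity.\<close>

lemma dim_weight_space_eq:
  assumes S: "stable S"
  shows "dim {v \<in> S. H v = scale (of_nat n) v}
    = dim {v \<in> S. E v = 0 \<and> H v = scale (of_nat n) v} + dim {v \<in> S. H v = scale (of_nat (n + 2)) v}"
proof -
  let ?X = "{v \<in> S. H v = scale (of_nat n) v}"
  have "E ` ?X = {v \<in> S. H v = scale (of_nat (n + 2)) v}" (is "_ = ?Y")
  proof (intro equalityI subsetI)
    fix w assume "w \<in> E ` ?X"
    then show "w \<in> ?Y"
      using S by (auto simp: HE E.scale scale_left_distrib stable_def)
  next
    fix w assume w: "w \<in> ?Y"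
    then have w': "w \<in> S" "H w = scale (of_nat (n + 2)) w" by simp_all
    have "subspace S" using S by (simp add: stable_def)
    then obtain u where "u \<in> S" "E u = w" "H u = scale (of_nat (n + 2) - 2) u"
      using E_preimage[OF w'(2) _ _ stable_funpow(2)[OF S stable_funpow(1)[OF S w'(1)]]] by auto
    then show "w \<in> E ` ?X" by auto
  qed
  moreover have "subspace ?X"
    using S by (auto simp: stable_def subspace_def H.add H.scale H.zero scale_right_distrib mult.commute)
  moreover have "{v \<in> ?X. E v = 0} = {v \<in> S. E v = 0 \<and> H v = scale (of_nat n) v}"
    by auto
  ultimately show ?thesis
    using rank_nullity_subspace[OF E.linear_axioms, of ?X] by simp
qed

text \<open>With this normalisation the ladder corresponds to the monomials \<open>X\<^sup>n\<^sup>-\<^sup>i Y\<^sup>i\<close> of \<open>V(n)\<close>.\<close>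

definition ladder :: "nat \<Rightarrow> 'v \<Rightarrow> nat \<Rightarrow> 'v" where
  "ladder n w i = scale (fact (n - i) / fact n) ((F ^^ i) w)"

lemma ladder_0 [simp]: "ladder n w 0 = w"
  by (simp add: ladder_def)

lemma H_ladder:
  assumes "H w = scale (of_nat n) w"
  shows "H (ladder n w i) = scale (of_nat n - 2 * of_nat i) (ladder n w i)"
  unfolding ladder_def H.scale H_F_funpow assms funpow_diff_scale
  by (simp add: scale_left_diff_distrib[symmetric] mult.commute)

lemma E_ladder:
  assumes "E w = 0" "H w = scale (of_nat n) w" "i \<le> n"
  shows "E (ladder n w i) = scale (of_nat i) (ladder n w (i - 1))"
proof (cases i)
  case (Suc j)
  then have n: "n - j = Suc (n - i)" using assms(3) by simp
  have "of_nat n - of_nat i + 1 = (of_nat (n - j) :: complex)"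
    using assms(3) Suc by (simp add: of_nat_diff)
  then show ?thesis
    using E_F_funpow_highest[OF assms(1,2), of i]
    by (simp add: ladder_def E.scale Suc n mult.commute del: funpow.simps of_nat_Suc)
qed (use assms in simp)

lemma F_ladder:
  assumes "E w = 0" "H w = scale (of_nat n) w" "i \<le> n"
  shows "F (ladder n w i) = scale (of_nat n - of_nat i) (ladder n w (Suc i))"
proof (cases "i = n")
  case True
  have "(F ^^ Suc n) w = 0"
  proof (cases "w = 0")
    case False
    then show ?thesis by (rule highest_weight_natural[OF _ assms(1,2)]) simp
  qed (simp add: funpow_diff_scale F.zero)
  then show ?thesis using True by (simp add: ladder_def F.scale)
next
  case False
  then have n: "n - i = Suc (n - Suc i)" using assms(3) by simp
  have "of_nat n - of_nat i = (of_nat (n - i) :: complex)"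
    using assms(3) by (simp add: of_nat_diff)
  then show ?thesis by (simp add: ladder_def F.scale n del: of_nat_Suc)
qed

text \<open>In the polynomial model E is X d/dY, so its p-th power on Y^i produces the falling
  factorial i! / (i - p)! and vanishes for p > i.\<close>

lemma E_funpow_ladder:
  assumes "E w = 0" "H w = scale (of_nat n) w" "i \<le> n"
  shows "p \<le> i \<Longrightarrow> (E ^^ p) (ladder n w i) = scale (fact i / fact (i - p)) (ladder n w (i - p))"
    and "i < p \<Longrightarrow> (E ^^ p) (ladder n w i) = 0"
proof -
  show *: "p \<le> i \<Longrightarrow> (E ^^ p) (ladder n w i) = scale (fact i / fact (i - p)) (ladder n w (i - p))" for p
  proof (induction p)
    case (Suc p)
    then have ip: "i - p = Suc (i - Suc p)" by simp
    have "(E ^^ Suc p) (ladder n w i) = scale (fact i / fact (i - p)) (E (ladder n w (i - p)))"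
      using Suc by (simp add: E.scale)
    also have "\<dots> = scale (fact i / fact (i - p) * of_nat (i - p)) (ladder n w (i - Suc p))"
      using E_ladder[OF assms(1,2), of "i - p"] assms(3) by simp
    also have "fact i / fact (i - p) * of_nat (i - p) = (fact i / fact (i - Suc p) :: complex)"
      unfolding ip by (simp del: of_nat_Suc)
    finally show ?case .
  qed simp
  assume "i < p"
  then obtain m where "p = m + Suc i"
    using less_imp_add_positive by (metis Suc_leI add.commute le_Suc_ex)
  then have "(E ^^ p) (ladder n w i) = (E ^^ m) (E ((E ^^ i) (ladder n w i)))"
    by (simp add: funpow_add funpow_swap1)
  also have "E ((E ^^ i) (ladder n w i)) = 0"
    by (simp add: * E.scale assms)
  also have "(E ^^ k) 0 = 0" for k by (induction k) (simp_all add: E.zero)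
  finally show "(E ^^ p) (ladder n w i) = 0" .
qed

text \<open>The coordinate form of equivariance for one copy: the action on coefficients in V(n)
  matches the action of the triple on the ladder.\<close>

lemma sum_V_act_ladder:
  assumes w: "E w = 0" "H w = scale (of_nat n) w"
    and f: "f \<in> V n" and x: "x $ 2 $ 2 = - x $ 1 $ 1"
  shows "(\<Sum>i\<le>n. scale (V_act n x f i) (ladder n w i))
    = (\<Sum>i\<le>n. scale (f i) (scale (x $ 1 $ 1) (H (ladder n w i))
        + scale (x $ 1 $ 2) (E (ladder n w i)) + scale (x $ 2 $ 1) (F (ladder n w i))))"
proof -
  let ?l = "ladder n w"
  \<comment> \<open>The diagonal, raising and lowering contributions. Shifting the indices of the
    last two is harmless: e(0) and g(n+1) have the factor zero, e(n+1) contains f(n+1) = 0, and g(0)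
    is set to 0.\<close>
  define h where "h = (\<lambda>i. scale ((of_nat n - 2 * of_nat i) * x $ 1 $ 1 * f i) (?l i))"
  define e where "e = (\<lambda>i. scale (of_nat i * x $ 1 $ 2 * f i) (?l (i - 1)))"
  define g where "g = (\<lambda>i. if i = 0 then 0 else
    scale ((of_nat n - of_nat i + 1) * x $ 2 $ 1 * f (i - 1)) (?l i))"
  have "(\<Sum>i\<le>n. scale (V_act n x f i) (?l i)) = (\<Sum>i\<le>n. h i + e (Suc i) + g i)"
  proof (intro sum.cong refl)
    fix i
    have "V_act n x f i = (of_nat n - 2 * of_nat i) * x $ 1 $ 1 * f i + of_nat (Suc i) * x $ 1 $ 2 * f (Suc i)
      + (if i = 0 then 0 else (of_nat n - of_nat i + 1) * x $ 2 $ 1 * f (i - 1))"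
      by (simp add: V_act_def x algebra_simps)
    then show "scale (V_act n x f i) (?l i) = h i + e (Suc i) + g i"
      by (simp only: scale_left_distrib h_def e_def g_def) simp
  qed
  also have "\<dots> = (\<Sum>i\<le>n. h i) + (\<Sum>i\<le>n. e (Suc i)) + (\<Sum>i\<le>n. g i)"
    by (simp add: sum.distrib)
  also have "(\<Sum>i\<le>n. e (Suc i)) = (\<Sum>i\<le>Suc n. e i)"
    unfolding sum.atMost_Suc_shift by (simp add: e_def)
  also have "(\<Sum>i\<le>Suc n. e i) = (\<Sum>i\<le>n. e i)"
    using f by (simp add: e_def V_def)
  also have "(\<Sum>i\<le>n. g i) = (\<Sum>i\<le>Suc n. g i)"
    by (simp add: g_def)
  also have "\<dots> = (\<Sum>i\<le>n. g (Suc i))"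
    unfolding sum.atMost_Suc_shift by (simp add: g_def)
  also have "(\<Sum>i\<le>n. h i) + (\<Sum>i\<le>n. e i) + (\<Sum>i\<le>n. g (Suc i)) = (\<Sum>i\<le>n. h i + e i + g (Suc i))"
    by (simp add: sum.distrib)
  also have "\<dots> = (\<Sum>i\<le>n. scale (f i) (scale (x $ 1 $ 1) (H (?l i))
        + scale (x $ 1 $ 2) (E (?l i)) + scale (x $ 2 $ 1) (F (?l i))))"
    by (intro sum.cong refl)
      (simp add: h_def e_def g_def H_ladder[OF w(2)] E_ladder[OF w] F_ladder[OF w]
        scale_right_distrib mult_ac)
  finally show ?thesis .
qed

end

section \<open>Irreducible modules over the sum of three copies\<close>

definition E_mat :: mat2 where "E_mat = vector [vector [0, 1], vector [0, 0]]"
definition F_mat :: mat2 where "F_mat = vector [vector [0, 0], vector [1, 0]]"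

lemma mat2_entries [simp]:
  "E_mat $ 1 $ 1 = 0" "E_mat $ 1 $ 2 = 1" "E_mat $ 2 $ 1 = 0" "E_mat $ 2 $ 2 = 0"
  "F_mat $ 1 $ 1 = 0" "F_mat $ 1 $ 2 = 0" "F_mat $ 2 $ 1 = 1" "F_mat $ 2 $ 2 = 0"
  "H_mat $ 1 $ 1 = 1" "H_mat $ 1 $ 2 = 0" "H_mat $ 2 $ 1 = 0" "H_mat $ 2 $ 2 = -1"
  by (simp_all add: E_mat_def F_mat_def H_mat_def)

lemma in_sl2_iff: "x \<in> sl2 \<longleftrightarrow> x $ 2 $ 2 = - x $ 1 $ 1"
  by (auto simp: sl2_def trace_def sum_2 eq_neg_iff_add_eq_0 add.commute)

lemma sl2_basis [simp]: "E_mat \<in> sl2" "F_mat \<in> sl2" "H_mat \<in> sl2" "0 \<in> sl2" "x \<in> sl2 \<Longrightarrow> mat_scale c x \<in> sl2"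
  by (auto simp: in_sl2_iff mat_scale_def)

lemma sl2_decomposition:
  assumes "x \<in> sl2"
  shows "x = mat_scale (x $ 1 $ 1) H_mat + (mat_scale (x $ 1 $ 2) E_mat + mat_scale (x $ 2 $ 1) F_mat)"
  using assms by (simp add: vec_eq_iff forall_2 mat_scale_def in_sl2_iff)

lemma commutator_basis:
  "commutator H_mat E_mat = mat_scale 2 E_mat"
  "commutator H_mat F_mat = mat_scale (-2) F_mat"
  "commutator E_mat F_mat = H_mat"
  by (simp_all add: vec_eq_iff forall_2 mat_scale_def commutator_def matrix_matrix_mult_def sum_2)

text \<open>A numerical index for the three embeddings lets the theory of a triple be interpreted
  once for all copies. Indices above 2 give 0, and the zero operators still satisfy the
  relations.\<close>

definition component :: "nat \<Rightarrow> mat2 \<Rightarrow> mat2 \<times> mat2 \<times> mat2" where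
  "component i x = (if i = 0 then x else 0, if i = 1 then x else 0, if i = 2 then x else 0)"

lemma component_in_sl2_cubed [simp]: "x \<in> sl2 \<Longrightarrow> component i x \<in> sl2_cubed"
  by (simp add: component_def sl2_cubed_def)

lemma component_add: "component i (x + y) = component i x + component i y"
  by (simp add: component_def)

lemma component_mat_scale: "component i (mat_scale c x) = scale_cubed c (component i x)"
  by (simp add: component_def scale_cubed_def mat_scale_def vec_eq_iff)

lemma bracket_component:
  "bracket_cubed (component i x) (component i y) = component i (commutator x y)"
  "i \<noteq> j \<Longrightarrow> bracket_cubed (component i x) (component j y) = 0"
  by (auto simp: component_def bracket_cubed_def commutator_def zero_prod_def)

lemma H_component: "H1 = component 0 H_mat" "H2 = component 1 H_mat" "H3 = component 2 H_mat"
  by (simp_all add: H1_def H2_def H3_def component_def)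

locale sl2_cubed_fd_module = sl2_cubed_module scale act + complex_fd_space scale Basis
  for scale :: "complex \<Rightarrow> 'v::ab_group_add \<Rightarrow> 'v" and act and Basis
begin

definition cact :: "nat \<Rightarrow> mat2 \<Rightarrow> 'v \<Rightarrow> 'v" where
  "cact i x v = act (component i x) v"

lemma cact_linear:
  assumes "x \<in> sl2"
  shows "Vector_Spaces.linear scale scale (cact i x)"
  by unfold_locales (simp_all add: cact_def act_add_right act_scale_right assms)

lemma act_0: "act 0 v = 0"
proof -
  have "scale_cubed 0 0 = (0 :: mat2 \<times> mat2 \<times> mat2)"
    by (simp add: scale_cubed_def mat_scale_def zero_prod_def vec_eq_iff)
  moreover have "(0 :: mat2 \<times> mat2 \<times> mat2) \<in> sl2_cubed"
    by (simp add: sl2_cubed_def zero_prod_def)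
  ultimately show ?thesis using act_scale_left[of 0 0 v] by simp
qed

lemma cact_commutator:
  assumes "x \<in> sl2" "y \<in> sl2"
  shows "cact i (commutator x y) v = cact i x (cact i y v) - cact i y (cact i x v)"
  using act_bracket[of "component i x" "component i y" v] assms
  by (simp add: cact_def bracket_component)

lemma cact_commute:
  assumes "x \<in> sl2" "y \<in> sl2" "i \<noteq> j"
  shows "cact i x (cact j y v) = cact j y (cact i x v)"
  using act_bracket[of "component i x" "component j y" v] assms
  by (simp add: cact_def bracket_component act_0)

lemma cact_mat_scale: "x \<in> sl2 \<Longrightarrow> cact i (mat_scale c x) v = scale c (cact i x v)"
  by (simp add: cact_def component_mat_scale act_scale_left)

lemma cact_add: "x \<in> sl2 \<Longrightarrow> y \<in> sl2 \<Longrightarrow> cact i (x + y) v = cact i x v + cact i y v"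
  by (simp add: cact_def component_add act_add_left)

lemma sl2_add: "x \<in> sl2 \<Longrightarrow> y \<in> sl2 \<Longrightarrow> x + y \<in> sl2"
  by (simp add: in_sl2_iff)

lemma cact_decomposition:
  assumes "x \<in> sl2"
  shows "cact i x v = scale (x $ 1 $ 1) (cact i H_mat v) + scale (x $ 1 $ 2) (cact i E_mat v)
    + scale (x $ 2 $ 1) (cact i F_mat v)"
  by (subst sl2_decomposition[OF assms])
    (simp only: cact_add cact_mat_scale sl2_add sl2_basis simp_thms disj_not1 add.assoc)

lemma act_eq_cact:
  assumes "x \<in> sl2" "y \<in> sl2" "z \<in> sl2"
  shows "act (x, y, z) v = cact 0 x v + cact 1 y v + cact 2 z v"
proof -
  have "(x, y, z) = component 0 x + (component 1 y + component 2 z)"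
    by (simp add: component_def)
  moreover have "component 1 y + component 2 z \<in> sl2_cubed"
    using assms by (simp add: component_def sl2_cubed_def)
  ultimately show ?thesis
    by (simp add: cact_def act_add_left assms add.assoc)
qed

sublocale T: sl2_triple scale Basis "cact i E_mat" "cact i F_mat" "cact i H_mat" for i
proof -
  interpret E: Vector_Spaces.linear scale scale "cact i E_mat" by (rule cact_linear) simp
  interpret F: Vector_Spaces.linear scale scale "cact i F_mat" by (rule cact_linear) simp
  interpret H: Vector_Spaces.linear scale scale "cact i H_mat" by (rule cact_linear) simp
  show "sl2_triple scale Basis (cact i E_mat) (cact i F_mat) (cact i H_mat)"
  proof unfold_locales
    fix v
    show "cact i H_mat (cact i E_mat v) = cact i E_mat (cact i H_mat v) + scale 2 (cact i E_mat v)"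
      using cact_commutator[of H_mat E_mat i v] by (simp add: commutator_basis cact_mat_scale algebra_simps)
    show "cact i H_mat (cact i F_mat v) = cact i F_mat (cact i H_mat v) - scale 2 (cact i F_mat v)"
      using cact_commutator[of H_mat F_mat i v] by (simp add: commutator_basis cact_mat_scale algebra_simps)
    show "cact i E_mat (cact i F_mat v) = cact i F_mat (cact i E_mat v) + cact i H_mat v"
      using cact_commutator[of E_mat F_mat i v] by (simp add: commutator_basis algebra_simps)
  qed
qed

lemma submodule_stable: "submodule W \<Longrightarrow> T.stable i W"
  by (simp add: submodule_def T.stable_def cact_def)

lemma submodule_cact: "submodule W \<Longrightarrow> x \<in> sl2 \<Longrightarrow> w \<in> W \<Longrightarrow> cact i x w \<in> W"
  by (simp add: submodule_def cact_def)

definition highest_weight_space :: "nat \<Rightarrow> nat \<Rightarrow> nat \<Rightarrow> 'v set" where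
  "highest_weight_space n\<^sub>1 n\<^sub>2 n\<^sub>3 = {v.
     cact 0 E_mat v = 0 \<and> cact 0 H_mat v = scale (of_nat n\<^sub>1) v \<and>
     cact 1 E_mat v = 0 \<and> cact 1 H_mat v = scale (of_nat n\<^sub>2) v \<and>
     cact 2 E_mat v = 0 \<and> cact 2 H_mat v = scale (of_nat n\<^sub>3) v}"

end

section \<open>The tensor product modules in coordinates\<close>

lemma sum_fun_apply: "sum g A x = (\<Sum>a\<in>A. g a x)"
  by (induction A rule: infinite_finite_induct) auto

text \<open>A function supported in the box is a finite combination of products of Kronecker deltas,
  each of which is a pure tensor.\<close>

lemma V_tensor_eq:
  "V_tensor n\<^sub>1 n\<^sub>2 n\<^sub>3 = {t. \<forall>i j k. i > n\<^sub>1 \<or> j > n\<^sub>2 \<or> k > n\<^sub>3 \<longrightarrow> t (i, j, k) = 0}" (is "_ = ?R")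
proof -
  interpret vector_space "fun_scale :: complex \<Rightarrow> (nat \<times> nat \<times> nat \<Rightarrow> complex) \<Rightarrow> _"
    by (rule vector_space_fun_scale)
  let ?P = "{pure_tensor u v w | u v w. u \<in> V n\<^sub>1 \<and> v \<in> V n\<^sub>2 \<and> w \<in> V n\<^sub>3}"
  let ?B = "{..n\<^sub>1} \<times> {..n\<^sub>2} \<times> {..n\<^sub>3}"
  let ?\<delta> = "\<lambda>i i'. of_bool (i' = i) :: complex"
  have "span ?P \<subseteq> ?R"
    by (rule span_minimal) (auto simp: subspace_def fun_scale_def pure_tensor_def V_def)
  moreover have "t \<in> span ?P" if t: "t \<in> ?R" for t
  proof -
    have "t = (\<Sum>(i, j, k)\<in>?B. fun_scale (t (i, j, k)) (pure_tensor (?\<delta> i) (?\<delta> j) (?\<delta> k)))" (is "_ = sum ?g ?B")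
    proof
      fix p
      have "sum ?g ?B p = (\<Sum>q\<in>?B. ?g q p)"
        by (rule sum_fun_apply)
      also have "\<dots> = (\<Sum>q\<in>?B. if q = p then t p else 0)"
        by (intro sum.cong refl) (auto simp: fun_scale_def pure_tensor_def split: prod.splits)
      also have "\<dots> = t p"
        using t by (cases p) (auto simp: sum.delta not_le)
      finally show "t p = sum ?g ?B p" by simp
    qed
    moreover have "sum ?g ?B \<in> span ?P"
    proof (rule span_sum)
      fix q
      assume "q \<in> ?B"
      then obtain i j k where q: "q = (i, j, k)" "i \<le> n\<^sub>1" "j \<le> n\<^sub>2" "k \<le> n\<^sub>3" by auto
      then have "?\<delta> i \<in> V n\<^sub>1" "?\<delta> j \<in> V n\<^sub>2" "?\<delta> k \<in> V n\<^sub>3" by (auto simp: V_def)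
      then have "pure_tensor (?\<delta> i) (?\<delta> j) (?\<delta> k) \<in> ?P" by blast
      then show "?g q \<in> span ?P" unfolding q prod.case by (intro span_scale span_base)
    qed
    ultimately show ?thesis by simp
  qed
  ultimately show ?thesis unfolding V_tensor_def by blast
qed

text \<open>The tensor product of the top powers of X, hence the highest weight vector. Coordinates
  count powers of Y, so the same function serves for all highest weights.\<close>

definition origin :: "nat \<times> nat \<times> nat \<Rightarrow> complex" where
  "origin = (\<lambda>p. of_bool (p = (0, 0, 0)))"

lemma origin_in_V_tensor: "origin \<in> V_tensor n\<^sub>1 n\<^sub>2 n\<^sub>3"
  by (simp add: V_tensor_eq origin_def)

lemma V_tensor_act_closed:
  assumes "t \<in> V_tensor n\<^sub>1 n\<^sub>2 n\<^sub>3"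
  shows "V_tensor_act n\<^sub>1 n\<^sub>2 n\<^sub>3 g t \<in> V_tensor n\<^sub>1 n\<^sub>2 n\<^sub>3"
proof -
  obtain x y z where g: "g = (x, y, z)" by (cases g)
  have "(\<lambda>i'. t (i', j, k)) \<in> V n\<^sub>1" "(\<lambda>j'. t (i, j', k)) \<in> V n\<^sub>2" "(\<lambda>k'. t (i, j, k')) \<in> V n\<^sub>3" for i j k
    using assms by (auto simp: V_tensor_eq V_def)
  note closed = this[THEN V_act_closed]
  have c1: "V_act n\<^sub>1 x (\<lambda>i'. t (i', j, k)) i = 0" if "i > n\<^sub>1" for i j k
    using closed(1) that by (auto simp: V_def)
  have c2: "V_act n\<^sub>2 y (\<lambda>j'. t (i, j', k)) j = 0" if "j > n\<^sub>2" for i j k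
    using closed(2) that by (auto simp: V_def)
  have c3: "V_act n\<^sub>3 z (\<lambda>k'. t (i, j, k')) k = 0" if "k > n\<^sub>3" for i j k
    using closed(3) that by (auto simp: V_def)
  have zero: "V_act n x (\<lambda>_. 0) i = 0" for n x i
    by (simp add: V_act_def)
  have "V_act n\<^sub>1 x (\<lambda>i'. t (i', j, k)) i + V_act n\<^sub>2 y (\<lambda>j'. t (i, j', k)) j + V_act n\<^sub>3 z (\<lambda>k'. t (i, j, k')) k = 0"
    if "i > n\<^sub>1 \<or> j > n\<^sub>2 \<or> k > n\<^sub>3" for i j k
  proof -
    have "V_act n\<^sub>1 x (\<lambda>i'. t (i', j, k)) i = 0"
      using that assms c1 by (cases "i > n\<^sub>1") (auto simp: V_tensor_eq zero)
    moreover have "V_act n\<^sub>2 y (\<lambda>j'. t (i, j', k)) j = 0"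
      using that assms c2 by (cases "j > n\<^sub>2") (auto simp: V_tensor_eq zero)
    moreover have "V_act n\<^sub>3 z (\<lambda>k'. t (i, j, k')) k = 0"
      using that assms c3 by (cases "k > n\<^sub>3") (auto simp: V_tensor_eq zero)
    ultimately show ?thesis by simp
  qed
  then show ?thesis by (simp add: g V_tensor_act_def V_tensor_eq)
qed

lemma V_act_basis:
  "V_act n 0 f = (\<lambda>_. 0)"
  "V_act n E_mat f = (\<lambda>j. (of_nat j + 1) * f (j + 1))"
  "V_act n H_mat f = (\<lambda>j. (of_nat n - 2 * of_nat j) * f j)"
  by (auto simp: V_act_def algebra_simps)

lemma V_tensor_act_origin:
  "V_tensor_act n\<^sub>1 n\<^sub>2 n\<^sub>3 (component i E_mat) origin = 0"
  "V_tensor_act n\<^sub>1 n\<^sub>2 n\<^sub>3 (component 0 H_mat) origin = fun_scale (of_nat n\<^sub>1) origin"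
  "V_tensor_act n\<^sub>1 n\<^sub>2 n\<^sub>3 (component 1 H_mat) origin = fun_scale (of_nat n\<^sub>2) origin"
  "V_tensor_act n\<^sub>1 n\<^sub>2 n\<^sub>3 (component 2 H_mat) origin = fun_scale (of_nat n\<^sub>3) origin"
  by (auto simp: fun_eq_iff V_tensor_act_def component_def V_act_basis origin_def fun_scale_def)

context sl2_cubed_fd_module
begin

lemma funpow_cact_commute:
  assumes "x \<in> sl2" "y \<in> sl2" "i \<noteq> j"
  shows "cact i x ((cact j y ^^ k) v) = (cact j y ^^ k) (cact i x v)"
    and "(cact i x ^^ l) ((cact j y ^^ k) v) = (cact j y ^^ k) ((cact i x ^^ l) v)"
proof -
  show *: "cact i x ((cact j y ^^ k) v) = (cact j y ^^ k) (cact i x v)" for v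
    by (induction k) (simp_all add: cact_commute[OF assms])
  show "(cact i x ^^ l) ((cact j y ^^ k) v) = (cact j y ^^ k) ((cact i x ^^ l) v)"
    by (induction l) (simp_all add: *)
qed

lemma cact_ladder:
  assumes "x \<in> sl2" "i \<noteq> j"
  shows "cact i x (T.ladder j n w k) = T.ladder j n (cact i x w) k"
proof -
  interpret X: Vector_Spaces.linear scale scale "cact i x" by (rule cact_linear[OF assms(1)])
  show ?thesis by (simp add: T.ladder_def X.scale funpow_cact_commute assms)
qed

lemma linear_zero: "Vector_Spaces.linear scale scale T \<Longrightarrow> T 0 = 0"
proof -
  assume "Vector_Spaces.linear scale scale T"
  then interpret T': Vector_Spaces.linear scale scale T .
  show ?thesis by (rule T'.zero)
qed

lemma funpow_cact_zero: "x \<in> sl2 \<Longrightarrow> (cact i x ^^ k) 0 = 0"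
  by (induction k) (simp_all add: linear_zero[OF cact_linear])

lemma ladder_zero: "T.ladder j n 0 k = 0"
  by (simp add: T.ladder_def funpow_cact_zero)

lemma ladder_scale: "T.ladder j n (scale c w) k = scale c (T.ladder j n w k)"
  by (simp add: T.ladder_def T.funpow_diff_scale)

lemma ladder_commute:
  "i \<noteq> j \<Longrightarrow> T.ladder i n (T.ladder j m w b) a = T.ladder j m (T.ladder i n w a) b"
  by (simp add: T.ladder_def T.funpow_diff_scale funpow_cact_commute(2)[of F_mat F_mat i j] mult.commute)

text \<open>A monomial in the three commuting raising operators, used to recover a highest weight
  vector from a combination of ladder vectors.\<close>

definition raise :: "nat \<times> nat \<times> nat \<Rightarrow> 'v \<Rightarrow> 'v" where
  "raise = (\<lambda>(i, j, k) w. (cact 0 E_mat ^^ i) ((cact 1 E_mat ^^ j) ((cact 2 E_mat ^^ k) w)))"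

text \<open>Each equation lets a different copy act first, so that vanishing can be read off from
  that copy alone.\<close>

lemma raise_alt:
  "raise (i, j, k) w = (cact 1 E_mat ^^ j) ((cact 2 E_mat ^^ k) ((cact 0 E_mat ^^ i) w))"
  "raise (i, j, k) w = (cact 0 E_mat ^^ i) ((cact 2 E_mat ^^ k) ((cact 1 E_mat ^^ j) w))"
  "raise (i, j, k) w = (cact 0 E_mat ^^ i) ((cact 1 E_mat ^^ j) ((cact 2 E_mat ^^ k) w))"
  by (simp add: raise_def funpow_cact_commute(2)[of E_mat E_mat 0 1]
      funpow_cact_commute(2)[of E_mat E_mat 0 2] del: One_nat_def)
    (simp_all add: raise_def funpow_cact_commute(2)[of E_mat E_mat 1 2] del: One_nat_def)

lemma raise_linear: "Vector_Spaces.linear scale scale (raise p)"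
proof -
  have *: "(cact i E_mat ^^ k) (a + b) = (cact i E_mat ^^ k) a + (cact i E_mat ^^ k) b"
    "(cact i E_mat ^^ k) (scale c a) = scale c ((cact i E_mat ^^ k) a)" for i k a b c
    by (induction k) (simp_all add: T.E.add T.E.scale)
  show ?thesis
    by unfold_locales (simp_all add: raise_def * split: prod.split)
qed

lemma raise_submodule: "submodule W \<Longrightarrow> w \<in> W \<Longrightarrow> raise p w \<in> W"
  using T.stable_funpow(1)[OF submodule_stable] by (cases p) (auto simp: raise_def)

section \<open>The submodule generated by one highest weight vector\<close>

context
  fixes v :: 'v and n\<^sub>1 n\<^sub>2 n\<^sub>3 :: nat
  assumes v: "v \<in> highest_weight_space n\<^sub>1 n\<^sub>2 n\<^sub>3"
begin

definition basis_vec :: "nat \<times> nat \<times> nat \<Rightarrow> 'v" where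
  "basis_vec = (\<lambda>(i, j, k). T.ladder 0 n\<^sub>1 (T.ladder 1 n\<^sub>2 (T.ladder 2 n\<^sub>3 v k) j) i)"

definition box :: "(nat \<times> nat \<times> nat) set" where
  "box = {..n\<^sub>1} \<times> {..n\<^sub>2} \<times> {..n\<^sub>3}"

definition tensor_map :: "(nat \<times> nat \<times> nat \<Rightarrow> complex) \<Rightarrow> 'v" where
  "tensor_map t = (\<Sum>p\<in>box. scale (t p) (basis_vec p))"

text \<open>Each equation makes the ladder of one copy outermost, which is the shape to which the
  formulas for a single triple apply.\<close>

lemma basis_vec_alt:
  "basis_vec (i, j, k) = T.ladder 0 n\<^sub>1 (T.ladder 1 n\<^sub>2 (T.ladder 2 n\<^sub>3 v k) j) i"
  "basis_vec (i, j, k) = T.ladder 1 n\<^sub>2 (T.ladder 0 n\<^sub>1 (T.ladder 2 n\<^sub>3 v k) i) j"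
  "basis_vec (i, j, k) = T.ladder 2 n\<^sub>3 (T.ladder 0 n\<^sub>1 (T.ladder 1 n\<^sub>2 v j) i) k"
  by (simp add: basis_vec_def)
    (simp add: basis_vec_def ladder_commute[of 0 1] del: One_nat_def,
      simp add: basis_vec_def ladder_commute[of 1 2] ladder_commute[of 0 2] del: One_nat_def)

text \<open>Lowering in two copies commutes with the third, so its highest weight equations
  survive.\<close>

lemma ladder_highest:
  "cact 0 E_mat (T.ladder 1 n\<^sub>2 (T.ladder 2 n\<^sub>3 v k) j) = 0"
  "cact 0 H_mat (T.ladder 1 n\<^sub>2 (T.ladder 2 n\<^sub>3 v k) j) = scale (of_nat n\<^sub>1) (T.ladder 1 n\<^sub>2 (T.ladder 2 n\<^sub>3 v k) j)"
  "cact 1 E_mat (T.ladder 0 n\<^sub>1 (T.ladder 2 n\<^sub>3 v k) i) = 0"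
  "cact 1 H_mat (T.ladder 0 n\<^sub>1 (T.ladder 2 n\<^sub>3 v k) i) = scale (of_nat n\<^sub>2) (T.ladder 0 n\<^sub>1 (T.ladder 2 n\<^sub>3 v k) i)"
  "cact 2 E_mat (T.ladder 0 n\<^sub>1 (T.ladder 1 n\<^sub>2 v j) i) = 0"
  "cact 2 H_mat (T.ladder 0 n\<^sub>1 (T.ladder 1 n\<^sub>2 v j) i) = scale (of_nat n\<^sub>3) (T.ladder 0 n\<^sub>1 (T.ladder 1 n\<^sub>2 v j) i)"
  using v by (simp_all add: highest_weight_space_def cact_ladder ladder_zero ladder_scale)

lemma finite_box: "finite box"
  by (simp add: box_def)

lemma sum_box:
  "sum g box = (\<Sum>j\<le>n\<^sub>2. \<Sum>k\<le>n\<^sub>3. \<Sum>i\<le>n\<^sub>1. g (i, j, k))"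
  "sum g box = (\<Sum>i\<le>n\<^sub>1. \<Sum>k\<le>n\<^sub>3. \<Sum>j\<le>n\<^sub>2. g (i, j, k))"
  "sum g box = (\<Sum>i\<le>n\<^sub>1. \<Sum>j\<le>n\<^sub>2. \<Sum>k\<le>n\<^sub>3. g (i, j, k))"
proof -
  show *: "sum g box = (\<Sum>i\<le>n\<^sub>1. \<Sum>j\<le>n\<^sub>2. \<Sum>k\<le>n\<^sub>3. g (i, j, k))"
    by (simp add: box_def sum.cartesian_product)
  show "sum g box = (\<Sum>i\<le>n\<^sub>1. \<Sum>k\<le>n\<^sub>3. \<Sum>j\<le>n\<^sub>2. g (i, j, k))"
    unfolding * by (intro sum.cong refl sum.swap)
  have "sum g box = (\<Sum>j\<le>n\<^sub>2. \<Sum>i\<le>n\<^sub>1. \<Sum>k\<le>n\<^sub>3. g (i, j, k))"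
    unfolding * by (rule sum.swap)
  also have "\<dots> = (\<Sum>j\<le>n\<^sub>2. \<Sum>k\<le>n\<^sub>3. \<Sum>i\<le>n\<^sub>1. g (i, j, k))"
    by (intro sum.cong refl sum.swap)
  finally show "sum g box = (\<Sum>j\<le>n\<^sub>2. \<Sum>k\<le>n\<^sub>3. \<Sum>i\<le>n\<^sub>1. g (i, j, k))" .
qed

lemma tensor_map_add: "tensor_map (s + t) = tensor_map s + tensor_map t"
  by (simp add: tensor_map_def scale_left_distrib sum.distrib)

lemma tensor_map_scale: "tensor_map (fun_scale c t) = scale c (tensor_map t)"
  by (simp add: tensor_map_def fun_scale_def scale_sum_right)

text \<open>With the other two indices fixed and the sum over the acting copy innermost, each
  equation is \<open>sum_V_act_ladder\<close> for one ladder.\<close>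

lemma cact_tensor_map:
  assumes x: "x \<in> sl2" and t: "t \<in> V_tensor n\<^sub>1 n\<^sub>2 n\<^sub>3"
  shows "(\<Sum>(i, j, k)\<in>box. scale (V_act n\<^sub>1 x (\<lambda>i'. t (i', j, k)) i) (basis_vec (i, j, k))) = cact 0 x (tensor_map t)"
    and "(\<Sum>(i, j, k)\<in>box. scale (V_act n\<^sub>2 x (\<lambda>j'. t (i, j', k)) j) (basis_vec (i, j, k))) = cact 1 x (tensor_map t)"
    and "(\<Sum>(i, j, k)\<in>box. scale (V_act n\<^sub>3 x (\<lambda>k'. t (i, j, k')) k) (basis_vec (i, j, k))) = cact 2 x (tensor_map t)"
proof -
  interpret X: Vector_Spaces.linear scale scale "cact i x" for i by (rule cact_linear[OF x])
  have x': "x $ 2 $ 2 = - x $ 1 $ 1" using x by (simp add: in_sl2_iff)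
  have tV: "(\<lambda>i'. t (i', j, k)) \<in> V n\<^sub>1" "(\<lambda>j'. t (i, j', k)) \<in> V n\<^sub>2" "(\<lambda>k'. t (i, j, k')) \<in> V n\<^sub>3" for i j k
    using t by (auto simp: V_tensor_eq V_def)
  note L = T.sum_V_act_ladder[OF _ _ _ x', folded cact_decomposition[OF x]]
  show "(\<Sum>(i, j, k)\<in>box. scale (V_act n\<^sub>1 x (\<lambda>i'. t (i', j, k)) i) (basis_vec (i, j, k))) = cact 0 x (tensor_map t)"
    unfolding tensor_map_def X.sum X.scale sum_box(1) basis_vec_alt(1)
    by (simp add: L[OF ladder_highest(1,2) tV(1)] del: One_nat_def)
  show "(\<Sum>(i, j, k)\<in>box. scale (V_act n\<^sub>2 x (\<lambda>j'. t (i, j', k)) j) (basis_vec (i, j, k))) = cact 1 x (tensor_map t)"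
    unfolding tensor_map_def X.sum X.scale sum_box(2) basis_vec_alt(2)
    by (simp add: L[OF ladder_highest(3,4) tV(2)] del: One_nat_def)
  show "(\<Sum>(i, j, k)\<in>box. scale (V_act n\<^sub>3 x (\<lambda>k'. t (i, j, k')) k) (basis_vec (i, j, k))) = cact 2 x (tensor_map t)"
    unfolding tensor_map_def X.sum X.scale sum_box(3) basis_vec_alt(3)
    by (simp add: L[OF ladder_highest(5,6) tV(3)] del: One_nat_def)
qed

lemma tensor_map_equivariant:
  assumes g: "g \<in> sl2_cubed" and t: "t \<in> V_tensor n\<^sub>1 n\<^sub>2 n\<^sub>3"
  shows "tensor_map (V_tensor_act n\<^sub>1 n\<^sub>2 n\<^sub>3 g t) = act g (tensor_map t)"
proof -
  obtain x y z where g': "g = (x, y, z)" "x \<in> sl2" "y \<in> sl2" "z \<in> sl2"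
    using g by (auto simp: sl2_cubed_def)
  show ?thesis
    unfolding g'(1) act_eq_cact[OF g'(2-)] cact_tensor_map[OF g'(2) t, symmetric]
      cact_tensor_map[OF g'(3) t, symmetric] cact_tensor_map[OF g'(4) t, symmetric] sum.distrib[symmetric]
    unfolding tensor_map_def
    by (intro sum.cong refl) (auto simp: V_tensor_act_def scale_left_distrib)
qed

lemma raise_basis_vec_0:
  assumes "(i', j', k') \<in> box" "i' < i \<or> j' < j \<or> k' < k"
  shows "raise (i, j, k) (basis_vec (i', j', k')) = 0"
  using assms(2)
proof (elim disjE)
  assume "i' < i"
  then have "(cact 0 E_mat ^^ i) (basis_vec (i', j', k')) = 0"
    unfolding basis_vec_alt(1) using assms(1)
    by (intro T.E_funpow_ladder(2) ladder_highest) (auto simp: box_def)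
  then show ?thesis by (simp add: raise_alt(1) funpow_cact_zero)
next
  assume "j' < j"
  then have "(cact 1 E_mat ^^ j) (basis_vec (i', j', k')) = 0"
    unfolding basis_vec_alt(2) using assms(1)
    by (intro T.E_funpow_ladder(2) ladder_highest) (auto simp: box_def)
  then show ?thesis by (simp add: raise_alt(2) funpow_cact_zero)
next
  assume "k' < k"
  then have "(cact 2 E_mat ^^ k) (basis_vec (i', j', k')) = 0"
    unfolding basis_vec_alt(3) using assms(1)
    by (intro T.E_funpow_ladder(2) ladder_highest) (auto simp: box_def)
  then show ?thesis by (simp add: raise_alt(3) funpow_cact_zero)
qed

text \<open>Raising each ladder all the way back to its start contributes one factorial per
  copy.\<close>

lemma raise_basis_vec:
  assumes "(i, j, k) \<in> box"
  shows "raise (i, j, k) (basis_vec (i, j, k)) = scale (fact i * fact j * fact k) v"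
proof -
  have lin: "(cact i E_mat ^^ k) (scale c a) = scale c ((cact i E_mat ^^ k) a)" for i k a c
    by (induction k) (simp_all add: T.E.scale)
  have "(cact 2 E_mat ^^ k) (basis_vec (i, j, k)) = scale (fact k) (basis_vec (i, j, 0))"
    unfolding basis_vec_alt(3) using assms
    by (subst T.E_funpow_ladder(1)[OF ladder_highest(5,6)]) (auto simp: box_def)
  moreover have "(cact 1 E_mat ^^ j) (basis_vec (i, j, 0)) = scale (fact j) (basis_vec (i, 0, 0))"
    unfolding basis_vec_alt(2) using assms
    by (subst T.E_funpow_ladder(1)[OF ladder_highest(3,4)]) (auto simp: box_def)
  moreover have "(cact 0 E_mat ^^ i) (basis_vec (i, 0, 0)) = scale (fact i) (basis_vec (0, 0, 0))"
    unfolding basis_vec_alt(1) using assms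
    by (subst T.E_funpow_ladder(1)[OF ladder_highest(1,2)]) (auto simp: box_def)
  ultimately show ?thesis
    by (simp add: raise_def lin mult_ac basis_vec_def)
qed

text \<open>
  Raising by a maximal index in the support of \<open>t\<close> annihilates all other terms of \<open>tensor_map t\<close>.
\<close>

lemma raise_tensor_map:
  assumes t: "t \<in> V_tensor n\<^sub>1 n\<^sub>2 n\<^sub>3" "t \<noteq> 0"
  obtains p c where "c \<noteq> 0" "raise p (tensor_map t) = scale c v"
proof -
  define A where "A = {p. t p \<noteq> 0}"
  \<comment> \<open>Maximality refers to the total degree i + j + k: every other index in the
    support is then strictly smaller in some coordinate.\<close>
  define size where "size = (\<lambda>(i, j, k). i + j + k :: nat)"
  have A: "A \<subseteq> box" "A \<noteq> {}"
    using t by (auto simp: A_def V_tensor_eq box_def not_le[symmetric] fun_eq_iff)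
  then have finA: "finite A" using finite_box finite_subset by blast
  have "Max (size ` A) \<in> size ` A" using finA A(2) by simp
  then obtain p where "p \<in> A" "size p = Max (size ` A)" by auto
  then have p: "p \<in> A" "\<And>q. q \<in> A \<Longrightarrow> size q \<le> size p" using finA by auto
  interpret R: Vector_Spaces.linear scale scale "raise p" by (rule raise_linear)
  obtain i j k where ijk: "p = (i, j, k)" by (cases p)
  have zero: "scale (t q) (raise p (basis_vec q)) = 0" if "q \<in> box - {p}" for q
  proof (cases "q \<in> A")
    case True
    obtain i' j' k' where q: "q = (i', j', k')" by (cases q)
    have "i' < i \<or> j' < j \<or> k' < k"
      using p(2)[OF True] that by (auto simp: q ijk size_def)
    then show ?thesis using raise_basis_vec_0 that by (simp add: q ijk)
  qed (simp add: A_def)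
  have pb: "p \<in> box" using p A by blast
  have "raise p (tensor_map t) = (\<Sum>q\<in>box. scale (t q) (raise p (basis_vec q)))"
    by (simp add: tensor_map_def R.sum R.scale)
  also have "\<dots> = scale (t p) (raise p (basis_vec p))"
    by (subst sum.remove[OF finite_box pb]) (simp add: sum.neutral zero)
  also have "\<dots> = scale (t p * (fact i * fact j * fact k)) v"
    using raise_basis_vec pb by (simp add: ijk)
  finally have r: "raise p (tensor_map t) = \<dots>" .
  show thesis by (rule that[OF _ r]) (use p(1) in \<open>simp add: A_def\<close>)
qed

lemma tensor_map_zero: "tensor_map 0 = 0"
  by (simp add: tensor_map_def)

lemma tensor_map_origin: "tensor_map origin = v"
proof -
  have "tensor_map origin = (\<Sum>p\<in>box. if p = (0, 0, 0) then basis_vec p else 0)"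
    unfolding tensor_map_def origin_def by (intro sum.cong) auto
  also have "\<dots> = v"
    using finite_box by (simp add: sum.delta basis_vec_def box_def)
  finally show ?thesis .
qed

lemma submodule_tensor_map_image: "submodule (tensor_map ` V_tensor n\<^sub>1 n\<^sub>2 n\<^sub>3)"
proof -
  let ?V = "V_tensor n\<^sub>1 n\<^sub>2 n\<^sub>3"
  have cl: "0 \<in> ?V" "\<And>s t. s \<in> ?V \<Longrightarrow> t \<in> ?V \<Longrightarrow> s + t \<in> ?V" "\<And>c t. t \<in> ?V \<Longrightarrow> fun_scale c t \<in> ?V"
    by (auto simp: V_tensor_eq fun_scale_def)
  have "subspace (tensor_map ` ?V)"
    unfolding subspace_def
    using cl tensor_map_zero[symmetric] tensor_map_add[symmetric] tensor_map_scale[symmetric] by (auto intro!: imageI)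
  then show ?thesis
    unfolding submodule_def using tensor_map_equivariant[symmetric] V_tensor_act_closed by auto
qed

lemma tensor_map_image_subset_submodule:
  assumes "submodule W" "v \<in> W"
  shows "tensor_map ` V_tensor n\<^sub>1 n\<^sub>2 n\<^sub>3 \<subseteq> W"
proof -
  have W: "subspace W" using assms by (simp add: submodule_def)
  have "T.ladder i n w k \<in> W" if "w \<in> W" for i n w k
    unfolding T.ladder_def using T.stable_funpow(2)[OF submodule_stable[OF assms(1)] that]
    by (intro subspace_scale[OF W])
  then have "basis_vec p \<in> W" for p
    using assms(2) by (cases p) (simp add: basis_vec_def)
  then show ?thesis
    unfolding tensor_map_def using W by (auto intro!: subspace_sum subspace_scale)
qed

text \<open>Some raising monomial takes a given nonzero element of the image to a nonzero multiple
  of v. So a nonzero submodule of the image contains v, and with it the whole image.\<close>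

lemma irreducible_tensor_map_image:
  assumes "v \<noteq> 0"
  shows "irreducible_submodule (tensor_map ` V_tensor n\<^sub>1 n\<^sub>2 n\<^sub>3)"
  unfolding irreducible_submodule_def
proof (intro conjI allI impI)
  show "tensor_map ` V_tensor n\<^sub>1 n\<^sub>2 n\<^sub>3 \<noteq> {0}"
    using assms tensor_map_origin origin_in_V_tensor by (metis imageI singletonD)
  fix W assume W: "submodule W \<and> W \<subseteq> tensor_map ` V_tensor n\<^sub>1 n\<^sub>2 n\<^sub>3"
  then have sW: "subspace W" by (simp add: submodule_def)
  show "W = {0} \<or> W = tensor_map ` V_tensor n\<^sub>1 n\<^sub>2 n\<^sub>3"
  proof (cases "W = {0}")
    case False
    then obtain w where w: "w \<in> W" "w \<noteq> 0" using subspace_0[OF sW] by blast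
    then obtain t where t: "t \<in> V_tensor n\<^sub>1 n\<^sub>2 n\<^sub>3" "w = tensor_map t" using W by blast
    with w have "t \<noteq> 0" using tensor_map_zero by auto
    then obtain p c where c: "c \<noteq> 0" "raise p w = scale c v"
      using raise_tensor_map t by metis
    then have "scale (inverse c) (scale c v) \<in> W"
      using raise_submodule W w sW by (metis subspace_scale)
    then have "v \<in> W" using c by simp
    then show ?thesis using tensor_map_image_subset_submodule W by blast
  qed simp
qed (rule submodule_tensor_map_image)

text \<open>Some raising monomial takes a nonzero w to a nonzero multiple of v. Since every E
  annihilates w, all exponents of that monomial are 0.\<close>

lemma highest_weight_unique:
  assumes w: "w \<in> tensor_map ` V_tensor n\<^sub>1 n\<^sub>2 n\<^sub>3" "w \<in> highest_weight_space n\<^sub>1 n\<^sub>2 n\<^sub>3" and "v \<noteq> 0"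
  obtains c where "w = scale c v"
proof (cases "w = 0")
  case True
  then show thesis using that[of 0] by simp
next
  case False
  obtain t where t: "t \<in> V_tensor n\<^sub>1 n\<^sub>2 n\<^sub>3" "w = tensor_map t" using w(1) by blast
  with False have "t \<noteq> 0" using tensor_map_zero by auto
  then obtain p c where c: "c \<noteq> 0" "raise p w = scale c v"
    using raise_tensor_map t by metis
  have z: "m = 0" if "(cact l E_mat ^^ m) w \<noteq> 0" "cact l E_mat w = 0" for l m
    using that by (cases m) (simp_all add: funpow_Suc_right funpow_cact_zero del: funpow.simps)
  obtain i j k where p: "p = (i, j, k)" by (cases p)
  have E: "cact 0 E_mat w = 0" "cact 1 E_mat w = 0" "cact 2 E_mat w = 0"
    using w(2) by (simp_all add: highest_weight_space_def)
  have nz: "raise p w \<noteq> 0" using c assms(3) by simp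
  have "i = 0" by (rule z[OF _ E(1)]) (use nz in \<open>auto simp: p raise_alt(1) funpow_cact_zero\<close>)
  moreover have "j = 0" by (rule z[OF _ E(2)]) (use nz in \<open>auto simp: p raise_alt(2) funpow_cact_zero\<close>)
  moreover have "k = 0" by (rule z[OF _ E(3)]) (use nz in \<open>auto simp: p raise_alt(3) funpow_cact_zero\<close>)
  ultimately have "w = scale c v" using c(2) by (simp add: p raise_def)
  then show thesis by (rule that)
qed

text \<open>Injectivity comes from raising: a nonzero tensor in the kernel would give a nonzero
  multiple of v equal to 0. The isomorphism is the inverse map, as the submodule is the
  source.\<close>

lemma tensor_map_isomorphism:
  assumes "v \<noteq> 0"
  shows "module_isomorphic sl2_cubed scale act (tensor_map ` V_tensor n\<^sub>1 n\<^sub>2 n\<^sub>3)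
    fun_scale (V_tensor_act n\<^sub>1 n\<^sub>2 n\<^sub>3) (V_tensor n\<^sub>1 n\<^sub>2 n\<^sub>3)"
proof -
  let ?V = "V_tensor n\<^sub>1 n\<^sub>2 n\<^sub>3"
  have cl: "\<And>s t. s \<in> ?V \<Longrightarrow> t \<in> ?V \<Longrightarrow> s + t \<in> ?V" "\<And>c t. t \<in> ?V \<Longrightarrow> fun_scale c t \<in> ?V"
    by (auto simp: V_tensor_eq fun_scale_def)
  have inj: "inj_on tensor_map ?V"
  proof (rule inj_onI)
    fix s t assume st: "s \<in> ?V" "t \<in> ?V" "tensor_map s = tensor_map t"
    let ?d = "s + fun_scale (-1) t"
    have d: "?d \<in> ?V" using cl st by blast
    have "tensor_map ?d = 0" using st by (simp add: tensor_map_add tensor_map_scale)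
    then have "?d = 0"
      using raise_tensor_map[OF d] linear_zero[OF raise_linear] assms
      by (metis scale_eq_0_iff)
    then show "s = t" by (auto simp: fun_scale_def fun_eq_iff)
  qed
  let ?\<psi> = "inv_into ?V tensor_map"
  have inv: "?\<psi> (tensor_map t) = t" if "t \<in> ?V" for t using inj that by simp
  show ?thesis
    unfolding module_isomorphic_def
  proof (intro exI conjI ballI allI)
    show "bij_betw ?\<psi> (tensor_map ` ?V) ?V"
      using inj by (simp add: bij_betw_inv_into inj_on_imp_bij_betw)
  qed (auto simp: inv cl V_tensor_act_closed simp flip: tensor_map_add tensor_map_scale tensor_map_equivariant)
qed

end

section \<open>Decompositions and the multiplicity formula\<close>

lemma stable_UNIV: "T.stable i UNIV"
  by (simp add: T.stable_def subspace_UNIV)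

text \<open>Copy j commutes with H of copy i and so preserves its eigenspaces. This and the next
  lemma allow the copies to be treated one after another.\<close>

lemma stable_weight:
  assumes S: "T.stable j S" and ij: "i \<noteq> j"
  shows "T.stable j {v \<in> S. cact i H_mat v = scale c v}"
  using S unfolding T.stable_def subspace_def
  by (auto simp: T.H.add T.H.scale T.H.zero T.E.scale T.F.scale scale_right_distrib mult.commute
      cact_commute[OF _ _ ij])

lemma stable_highest_weight:
  assumes S: "T.stable j S" and ij: "i \<noteq> j"
  shows "T.stable j {v \<in> S. cact i E_mat v = 0 \<and> cact i H_mat v = scale c v}"
  using S unfolding T.stable_def subspace_def
  by (auto simp: T.H.add T.H.scale T.H.zero T.E.add T.E.scale T.E.zero T.F.scale T.F.zero
      scale_right_distrib mult.commute cact_commute[OF _ _ ij])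

text \<open>The image is a nonzero submodule contained in N, so irreducibility leaves only
  equality.\<close>

lemma irreducible_eq_image:
  assumes N: "irreducible_submodule N" and v: "v \<in> N" "v \<noteq> 0" "v \<in> highest_weight_space n\<^sub>1 n\<^sub>2 n\<^sub>3"
  shows "N = tensor_map v n\<^sub>1 n\<^sub>2 n\<^sub>3 ` V_tensor n\<^sub>1 n\<^sub>2 n\<^sub>3"
proof -
  have "tensor_map v n\<^sub>1 n\<^sub>2 n\<^sub>3 ` V_tensor n\<^sub>1 n\<^sub>2 n\<^sub>3 \<noteq> {0}"
    using irreducible_tensor_map_image[OF v(3,2)] by (simp add: irreducible_submodule_def)
  then show ?thesis
    using N submodule_tensor_map_image[OF v(3)] tensor_map_image_subset_submodule[OF v(3) _ v(1)]
    unfolding irreducible_submodule_def by blast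
qed

text \<open>The preimage of \<open>origin\<close> inherits its highest weight equations through the
  injective equivariant map.\<close>

lemma isomorphic_imp_highest_weight_vector:
  assumes N: "submodule N"
    and iso: "module_isomorphic sl2_cubed scale act N
      fun_scale (V_tensor_act n\<^sub>1 n\<^sub>2 n\<^sub>3) (V_tensor n\<^sub>1 n\<^sub>2 n\<^sub>3)"
  obtains v where "v \<in> N" "v \<noteq> 0" "v \<in> highest_weight_space n\<^sub>1 n\<^sub>2 n\<^sub>3"
proof -
  obtain \<phi> where \<phi>: "bij_betw \<phi> N (V_tensor n\<^sub>1 n\<^sub>2 n\<^sub>3)"
      "\<And>u v. u \<in> N \<Longrightarrow> v \<in> N \<Longrightarrow> \<phi> (u + v) = \<phi> u + \<phi> v"
      "\<And>c v. v \<in> N \<Longrightarrow> \<phi> (scale c v) = fun_scale c (\<phi> v)"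
      "\<And>g v. g \<in> sl2_cubed \<Longrightarrow> v \<in> N \<Longrightarrow> \<phi> (act g v) = V_tensor_act n\<^sub>1 n\<^sub>2 n\<^sub>3 g (\<phi> v)"
    using iso unfolding module_isomorphic_def by blast
  have sub: "subspace N" using N by (simp add: submodule_def)
  have inj: "u = v" if "u \<in> N" "v \<in> N" "\<phi> u = \<phi> v" for u v
    using \<phi>(1) that by (auto simp: bij_betw_def inj_on_def)
  have \<phi>0: "\<phi> 0 = 0"
    using \<phi>(2)[of 0 0] subspace_0[OF sub] by simp
  obtain v where v: "v \<in> N" "\<phi> v = origin"
    using \<phi>(1) origin_in_V_tensor unfolding bij_betw_def by (metis imageE)
  have E: "cact i E_mat v = 0" if "V_tensor_act n\<^sub>1 n\<^sub>2 n\<^sub>3 (component i E_mat) origin = 0" for i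
  proof (rule inj)
    show "cact i E_mat v \<in> N" using submodule_cact[OF N _ v(1)] by simp
    show "\<phi> (cact i E_mat v) = \<phi> 0"
      using \<phi>(4)[OF _ v(1), of "component i E_mat"] that by (simp add: cact_def v \<phi>0)
  qed (rule subspace_0[OF sub])
  have H: "cact i H_mat v = scale c v"
    if "V_tensor_act n\<^sub>1 n\<^sub>2 n\<^sub>3 (component i H_mat) origin = fun_scale c origin" for i c
  proof (rule inj)
    show "cact i H_mat v \<in> N" using submodule_cact[OF N _ v(1)] by simp
    show "scale c v \<in> N" using sub v(1) by (rule subspace_scale)
    show "\<phi> (cact i H_mat v) = \<phi> (scale c v)"
      using \<phi>(4)[OF _ v(1), of "component i H_mat"] that by (simp add: cact_def v \<phi>(3))
  qed
  have "v \<in> highest_weight_space n\<^sub>1 n\<^sub>2 n\<^sub>3"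
    unfolding highest_weight_space_def mem_Collect_eq
    by (intro conjI E H V_tensor_act_origin)
  moreover have "v \<noteq> 0"
    using v(2) \<phi>0 by (auto simp: origin_def fun_eq_iff)
  ultimately show thesis using that v(1) by blast
qed

lemma irreducible_isomorphic_iff:
  assumes N: "irreducible_submodule N"
  shows "module_isomorphic sl2_cubed scale act N fun_scale (V_tensor_act n\<^sub>1 n\<^sub>2 n\<^sub>3) (V_tensor n\<^sub>1 n\<^sub>2 n\<^sub>3)
    \<longleftrightarrow> (\<exists>v\<in>N. v \<noteq> 0 \<and> v \<in> highest_weight_space n\<^sub>1 n\<^sub>2 n\<^sub>3)"
proof
  assume "module_isomorphic sl2_cubed scale act N fun_scale (V_tensor_act n\<^sub>1 n\<^sub>2 n\<^sub>3) (V_tensor n\<^sub>1 n\<^sub>2 n\<^sub>3)"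
  then show "\<exists>v\<in>N. v \<noteq> 0 \<and> v \<in> highest_weight_space n\<^sub>1 n\<^sub>2 n\<^sub>3"
    by (rule isomorphic_imp_highest_weight_vector[rotated])
      (use N in \<open>auto simp: irreducible_submodule_def\<close>)
next
  assume "\<exists>v\<in>N. v \<noteq> 0 \<and> v \<in> highest_weight_space n\<^sub>1 n\<^sub>2 n\<^sub>3"
  then obtain v where v: "v \<in> N" "v \<noteq> 0" "v \<in> highest_weight_space n\<^sub>1 n\<^sub>2 n\<^sub>3" by blast
  then show "module_isomorphic sl2_cubed scale act N fun_scale (V_tensor_act n\<^sub>1 n\<^sub>2 n\<^sub>3) (V_tensor n\<^sub>1 n\<^sub>2 n\<^sub>3)"
    using tensor_map_isomorphism[OF v(3,2)] irreducible_eq_image[OF N v] by simp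
qed

lemma irreducible_submodules_span:
  assumes Q: "subspace Q" and irr: "\<And>N. irreducible_submodule N \<Longrightarrow> N \<subseteq> Q"
  shows "Q = UNIV"
proof -
  define P where "P = span (\<Union>{N. irreducible_submodule N})"
  have "P \<subseteq> Q"
    unfolding P_def using Q irr by (intro span_minimal) auto
  have P: "subspace P" "\<And>N. irreducible_submodule N \<Longrightarrow> N \<subseteq> P"
    by (auto simp: P_def intro: span_base)
  have FP: "cact i F_mat v \<in> P" if "v \<in> P" for i v
    using that unfolding P_def
  proof (induction v rule: span_induct_alt)
    case (step c x y)
    then obtain N where "irreducible_submodule N" "x \<in> N" by blast
    then have "cact i F_mat x \<in> P"
      using P(2)[of N] submodule_cact[of N F_mat x i] by (auto simp: irreducible_submodule_def)
    with step show ?case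
      by (simp add: T.F.add T.F.scale P_def span_add span_scale)
  qed (simp add: T.F.zero span_zero)
  let ?A = "\<lambda>n. {v \<in> UNIV. cact 0 E_mat v = 0 \<and> cact 0 H_mat v = scale (of_nat n) v}"
  let ?B = "\<lambda>n m. {v \<in> ?A n. cact 1 E_mat v = 0 \<and> cact 1 H_mat v = scale (of_nat m) v}"
  have stA: "T.stable j (?A n)" if "j \<noteq> 0" for j n
    by (rule stable_highest_weight[OF stable_UNIV]) (use that in simp)
  have stB: "T.stable 2 (?B n m)" for n m
    by (rule stable_highest_weight[OF stA]) simp_all
  have hw: "v \<in> P" if "v \<in> highest_weight_space n\<^sub>1 n\<^sub>2 n\<^sub>3" for v n\<^sub>1 n\<^sub>2 n\<^sub>3
  proof (cases "v = 0")
    case False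
    have "v \<in> tensor_map v n\<^sub>1 n\<^sub>2 n\<^sub>3 ` V_tensor n\<^sub>1 n\<^sub>2 n\<^sub>3"
      using tensor_map_origin[OF that] origin_in_V_tensor by (metis imageI)
    then show ?thesis using P(2) irreducible_tensor_map_image[OF that False] by blast
  qed (simp add: subspace_0 P)
  \<comment> \<open>The copies are taken in reverse order: copy 2 inside \<open>?B\<close>, copy 1
    inside \<open>?A\<close>, copy 0 on the whole module. Each stage supplies the highest weight
    hypothesis of the next.\<close>
  have "?B n\<^sub>1 n\<^sub>2 \<subseteq> P" for n\<^sub>1 n\<^sub>2
    by (rule T.stable_subset_if_highest_weight_vectors[OF stB P(1) FP])
      (auto intro: hw simp: highest_weight_space_def)
  then have "?A n\<^sub>1 \<subseteq> P" for n\<^sub>1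
    by (intro T.stable_subset_if_highest_weight_vectors[OF stA[of 1] P(1) FP]) auto
  then have "UNIV \<subseteq> P"
    by (intro T.stable_subset_if_highest_weight_vectors[OF stable_UNIV[of 0] P(1) FP]) auto
  with \<open>P \<subseteq> Q\<close> show ?thesis by auto
qed

text \<open>Directness in zero-sum form, without requiring that the sum be the whole module, so that
  a maximal family can be sought.\<close>

definition direct_family :: "'v set set \<Rightarrow> bool" where
  "direct_family D \<longleftrightarrow> finite D \<and> (\<forall>N\<in>D. irreducible_submodule N) \<and>
     (\<forall>f. (\<forall>N\<in>D. f N \<in> N) \<and> (\<Sum>N\<in>D. f N) = 0 \<longrightarrow> (\<forall>N\<in>D. f N = 0))"

lemma irreducible_subspace: "irreducible_submodule N \<Longrightarrow> subspace N"
  by (simp add: irreducible_submodule_def submodule_def)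

lemma direct_familyD:
  assumes "direct_family D" "\<And>N. N \<in> D \<Longrightarrow> f N \<in> N" "(\<Sum>N\<in>D. f N) = 0" "N \<in> D"
  shows "f N = 0"
proof -
  have "(\<forall>N\<in>D. f N \<in> N) \<and> (\<Sum>N\<in>D. f N) = 0 \<longrightarrow> (\<forall>N\<in>D. f N = 0)"
    using assms(1) unfolding direct_family_def by blast
  then show ?thesis using assms by blast
qed

text \<open>A relation among vectors chosen from distinct summands, extended by zero to all of D, is
  a zero sum and thus trivial. This bounds the size of direct families and later gives a basis of
  the highest weight vectors.\<close>

lemma direct_family_choice_independent:
  assumes D: "direct_family D" and A: "A \<subseteq> D" and v: "\<And>N. N \<in> A \<Longrightarrow> v N \<in> N \<and> v N \<noteq> 0"
  shows "inj_on v A" "independent (v ` A)"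
proof -
  have finA: "finite A" using A D finite_subset by (auto simp: direct_family_def)
  have zero: "u N = 0" if "(\<Sum>N\<in>A. scale (u N) (v N)) = 0" "N \<in> A" for u N
  proof -
    let ?f = "\<lambda>N. if N \<in> A then scale (u N) (v N) else 0"
    have "(\<Sum>N\<in>D. ?f N) = (\<Sum>N\<in>A. scale (u N) (v N))"
      using A D by (intro sum.mono_neutral_cong_right) (auto simp: direct_family_def)
    moreover have "?f N \<in> N" if "N \<in> D" for N
    proof -
      have "subspace N" using D that by (simp add: direct_family_def irreducible_subspace)
      then show ?thesis using v by (simp add: subspace_0 subspace_scale)
    qed
    ultimately have "?f N = 0"
      using direct_familyD[OF D, of ?f N] that A by auto
    then have "scale (u N) (v N) = 0" using that by simp
    then show ?thesis using v that by simp
  qed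
  show inj: "inj_on v A"
  proof (rule inj_onI, rule ccontr)
    fix M N assume MN: "M \<in> A" "N \<in> A" "v M = v N" "M \<noteq> N"
    let ?u = "\<lambda>K. if K = M then 1 else if K = N then - 1 else (0 :: complex)"
    have "(\<Sum>K\<in>A. scale (?u K) (v K)) = (\<Sum>K\<in>{M, N}. scale (?u K) (v K))"
      using MN finA by (intro sum.mono_neutral_right) auto
    also have "\<dots> = 0" using MN by simp
    finally show False using zero[of ?u M] MN by simp
  qed
  show "independent (v ` A)"
  proof (rule independent_if_scalars_zero)
    fix u x assume "(\<Sum>x\<in>v ` A. scale (u x) x) = 0" "x \<in> v ` A"
    then show "u x = 0" using zero[of "u \<circ> v"] inj by (auto simp: sum.reindex)
  qed (use finA in simp)
qed

lemma irreducible_decomposition_iff: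
  "irreducible_decomposition D \<longleftrightarrow> direct_family D \<and> (\<forall>v. \<exists>f. (\<forall>N\<in>D. f N \<in> N) \<and> v = (\<Sum>N\<in>D. f N))"
proof
  assume D: "irreducible_decomposition D"
  have ex1: "\<exists>!f. f \<in> (\<Pi>\<^sub>E N\<in>D. N) \<and> v = (\<Sum>N\<in>D. f N)" for v
    using D by (simp add: irreducible_decomposition_def)
  have "f N = 0" if f: "\<forall>N\<in>D. f N \<in> N" "(\<Sum>N\<in>D. f N) = 0" and N: "N \<in> D" for f N
  proof -
    define P where "P = (\<lambda>f. f \<in> (\<Pi>\<^sub>E N\<in>D. N) \<and> 0 = (\<Sum>N\<in>D. f N))"
    \<comment> \<open>Unique existence concerns extensional functions only, so f is restricted
      before it is compared with the zero family.\<close>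
    have "P (restrict f D)"
      using f by (auto simp: P_def)
    moreover have "P (\<lambda>N\<in>D. 0)"
      using D by (auto simp: P_def irreducible_decomposition_def intro: subspace_0 irreducible_subspace)
    moreover have "\<exists>!f. P f" unfolding P_def by (rule ex1)
    ultimately have "restrict f D = (\<lambda>N\<in>D. 0)" by blast
    then have "restrict f D N = (\<lambda>N\<in>D. 0) N" by simp
    then show ?thesis using N by simp
  qed
  then have "direct_family D"
    using D unfolding direct_family_def irreducible_decomposition_def by simp
  moreover have "\<exists>f. (\<forall>N\<in>D. f N \<in> N) \<and> v = (\<Sum>N\<in>D. f N)" for v
    using ex1_implies_ex[OF ex1[of v]] unfolding PiE_iff by blast
  ultimately show "direct_family D \<and> (\<forall>v. \<exists>f. (\<forall>N\<in>D. f N \<in> N) \<and> v = (\<Sum>N\<in>D. f N))" by blast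
next
  assume D: "direct_family D \<and> (\<forall>v. \<exists>f. (\<forall>N\<in>D. f N \<in> N) \<and> v = (\<Sum>N\<in>D. f N))"
  have "\<exists>!f. f \<in> (\<Pi>\<^sub>E N\<in>D. N) \<and> v = (\<Sum>N\<in>D. f N)" for v
  proof -
    obtain f where f: "\<forall>N\<in>D. f N \<in> N" "v = (\<Sum>N\<in>D. f N)" using D by blast
    show ?thesis
    proof (intro ex1I[of _ "restrict f D"] conjI)
      fix g assume g: "g \<in> (\<Pi>\<^sub>E N\<in>D. N) \<and> v = (\<Sum>N\<in>D. g N)"
      have mem: "g N - f N \<in> N" if "N \<in> D" for N
      proof (rule subspace_diff)
        show "subspace N" using D that by (simp add: direct_family_def irreducible_subspace)
      qed (use f(1) g that in \<open>auto simp: PiE_iff\<close>)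
      have "(\<Sum>N\<in>D. g N - f N) = 0"
        using f g by (simp add: sum_subtractf)
      then have "g N - f N = 0" if "N \<in> D" for N
        using direct_familyD[of D "\<lambda>N. g N - f N"] D mem that by blast
      then show "g = restrict f D"
        using g by (intro ext) (auto simp: PiE_iff extensional_def)
    qed (use f in auto)
  qed
  then show "irreducible_decomposition D"
    using D by (simp add: irreducible_decomposition_def direct_family_def)
qed

lemma direct_family_insert:
  assumes D: "direct_family D" and N: "irreducible_submodule N"
    and disj: "\<And>f. \<lbrakk>\<forall>M\<in>D. f M \<in> M; (\<Sum>M\<in>D. f M) \<in> N\<rbrakk> \<Longrightarrow> (\<Sum>M\<in>D. f M) = 0"
    and ND: "N \<notin> D"
  shows "direct_family (insert N D)"
proof -
  have "\<forall>M\<in>insert N D. f M = 0" if f: "\<forall>M\<in>insert N D. f M \<in> M" "(\<Sum>M\<in>insert N D. f M) = 0" for f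
  proof -
    have sum: "f N + (\<Sum>M\<in>D. f M) = 0"
      using f(2) D ND by (simp add: direct_family_def)
    then have "(\<Sum>M\<in>D. f M) = - f N" by (simp add: eq_neg_iff_add_eq_0 add.commute)
    then have "(\<Sum>M\<in>D. f M) \<in> N"
      using f(1) N by (auto intro: subspace_neg irreducible_subspace)
    then have 0: "(\<Sum>M\<in>D. f M) = 0" using disj f by auto
    with D f(1) have "\<forall>M\<in>D. f M = 0" unfolding direct_family_def by blast
    with sum 0 show ?thesis by simp
  qed
  then show ?thesis using D N by (simp add: direct_family_def)
qed

text \<open>One nonzero vector from each member bounds the size of a direct family by the dimension,
  so a largest one exists. Its sum Q contains every irreducible N: otherwise N meets Q only in 0 and
  could be added. As the irreducibles span, Q is everything.\<close>

lemma irreducible_decomposition_exists: "\<exists>D. irreducible_decomposition D"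
proof -
  have bound: "card D \<le> dim (UNIV :: 'v set)" if "direct_family D" for D
  proof -
    have "\<exists>v. \<forall>N\<in>D. v N \<in> N \<and> v N \<noteq> 0"
    proof (intro bchoice ballI)
      fix N assume "N \<in> D"
      then have "irreducible_submodule N" using that by (simp add: direct_family_def)
      then show "\<exists>x. x \<in> N \<and> x \<noteq> 0"
        using irreducible_subspace[of N] subspace_0[of N] unfolding irreducible_submodule_def by blast
    qed
    then obtain v where v: "\<And>N. N \<in> D \<Longrightarrow> v N \<in> N \<and> v N \<noteq> 0" by blast
    have "card D = card (v ` D)"
      using direct_family_choice_independent(1)[OF that subset_refl v] by (simp add: card_image)
    also have "\<dots> \<le> dim (UNIV :: 'v set)"
      using direct_family_choice_independent(2)[OF that subset_refl v] by (intro independent_card_le_dim) auto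
    finally show ?thesis .
  qed
  have "direct_family {}" by (simp add: direct_family_def)
  then obtain D where D: "direct_family D" "\<And>D'. direct_family D' \<Longrightarrow> card D' \<le> card D"
    using ex_has_greatest_nat[of direct_family "{}" card "Suc (dim (UNIV :: 'v set))"] bound
    by (metis le_imp_less_Suc)
  define Q where "Q = {\<Sum>N\<in>D. f N |f. \<forall>N\<in>D. f N \<in> N}"
  have sD: "submodule N" "subspace N" if "N \<in> D" for N
    using D(1) that by (auto simp: direct_family_def irreducible_submodule_def submodule_def)
  have Q: "submodule Q"
    unfolding submodule_def subspace_def
  proof (intro conjI ballI allI)
    show "0 \<in> Q"
      unfolding Q_def by (rule CollectI, rule exI[of _ "\<lambda>_. 0"]) (simp add: sD subspace_0)
  next
    fix x y assume "x \<in> Q" "y \<in> Q"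
    then obtain f g where "\<forall>N\<in>D. f N \<in> N" "x = (\<Sum>N\<in>D. f N)" "\<forall>N\<in>D. g N \<in> N" "y = (\<Sum>N\<in>D. g N)"
      unfolding Q_def by blast
    then show "x + y \<in> Q"
      unfolding Q_def by (intro CollectI exI[of _ "\<lambda>N. f N + g N"]) (simp add: sD subspace_add sum.distrib)
  next
    fix c x assume "x \<in> Q"
    then obtain f where "\<forall>N\<in>D. f N \<in> N" "x = (\<Sum>N\<in>D. f N)"
      unfolding Q_def by blast
    then show "scale c x \<in> Q"
      unfolding Q_def
      by (intro CollectI exI[of _ "\<lambda>N. scale c (f N)"]) (simp add: sD subspace_scale scale_sum_right)
  next
    fix g x assume g: "g \<in> sl2_cubed" and "x \<in> Q"
    then obtain f where f: "\<forall>N\<in>D. f N \<in> N" "x = (\<Sum>N\<in>D. f N)"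
      unfolding Q_def by blast
    interpret g: Vector_Spaces.linear scale scale "act g"
      by unfold_locales (simp_all add: act_add_right act_scale_right g)
    show "act g x \<in> Q"
      unfolding Q_def
      by (intro CollectI exI[of _ "\<lambda>N. act g (f N)"])
        (use f g sD(1) in \<open>auto simp: submodule_def g.sum\<close>)
  qed
  have "N \<subseteq> Q" if N: "irreducible_submodule N" for N
  proof (rule ccontr)
    assume NQ: "\<not> N \<subseteq> Q"
    have NsubD: "M \<subseteq> Q" if "M \<in> D" for M
    proof
      fix x assume "x \<in> M"
      then show "x \<in> Q"
        unfolding Q_def using that sD D(1)
        by (intro CollectI exI[of _ "\<lambda>K. if K = M then x else 0"])
          (auto simp: subspace_0 direct_family_def)
    qed
    have "submodule (N \<inter> Q)"
      using N Q by (auto simp: submodule_def irreducible_submodule_def subspace_inter)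
    with N NQ have NQ0: "N \<inter> Q = {0}"
      unfolding irreducible_submodule_def by blast
    have ND: "N \<notin> D" using NQ NsubD by blast
    have "direct_family (insert N D)"
    proof (rule direct_family_insert[OF D(1) N _ ND])
      fix f assume "\<forall>M\<in>D. f M \<in> M" "(\<Sum>M\<in>D. f M) \<in> N"
      then have "(\<Sum>M\<in>D. f M) \<in> N \<inter> Q" unfolding Q_def by blast
      with NQ0 show "(\<Sum>M\<in>D. f M) = 0" by blast
    qed
    then have "card (insert N D) \<le> card D" by (rule D(2))
    then show False using ND D(1) by (simp add: direct_family_def)
  qed
  then have "Q = UNIV"
    using irreducible_submodules_span Q by (auto simp: submodule_def)
  then have "\<forall>v. \<exists>f. (\<forall>N\<in>D. f N \<in> N) \<and> v = (\<Sum>N\<in>D. f N)"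
    unfolding Q_def by blast
  then have "irreducible_decomposition D"
    using D(1) irreducible_decomposition_iff by blast
  then show ?thesis ..
qed

text \<open>One highest weight vector from each counted summand gives a basis of the highest weight
  space: independence is directness, and spanning holds since the components of a highest weight
  vector are again such vectors, unique up to scalars in each summand.\<close>

lemma summand_count_eq_dim:
  assumes D: "irreducible_decomposition D"
  shows "summand_count D n\<^sub>1 n\<^sub>2 n\<^sub>3 = dim (highest_weight_space n\<^sub>1 n\<^sub>2 n\<^sub>3)"
proof -
  let ?W = "highest_weight_space n\<^sub>1 n\<^sub>2 n\<^sub>3"
  have dir: "direct_family D" and span: "\<And>v. \<exists>f. (\<forall>N\<in>D. f N \<in> N) \<and> v = (\<Sum>N\<in>D. f N)"
    using D irreducible_decomposition_iff by auto
  have irr: "irreducible_submodule N" if "N \<in> D" for N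
    using dir that by (simp add: direct_family_def)
  define A where "A = {N \<in> D. \<exists>v\<in>N. v \<noteq> 0 \<and> v \<in> ?W}"
  have "\<exists>v. \<forall>N\<in>A. v N \<in> N \<and> v N \<noteq> 0 \<and> v N \<in> ?W"
    by (intro bchoice) (auto simp: A_def)
  then obtain v where v: "\<And>N. N \<in> A \<Longrightarrow> v N \<in> N \<and> v N \<noteq> 0 \<and> v N \<in> ?W" by blast
  have ind: "inj_on v A" "independent (v ` A)"
    using direct_family_choice_independent[OF dir, of A v] v by (auto simp: A_def)
  \<comment> \<open>An operator preserving every summand and killing a sum kills its components. It
    is applied to each E and to each H - c.\<close>
  have kernel: "\<forall>N\<in>D. L (f N) = 0"
    if "\<forall>N\<in>D. f N \<in> N" "L (\<Sum>N\<in>D. f N) = 0" "Vector_Spaces.linear scale scale L"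
      "\<And>N x. N \<in> D \<Longrightarrow> x \<in> N \<Longrightarrow> L x \<in> N" for f L
  proof -
    interpret L: Vector_Spaces.linear scale scale L by fact
    have "(\<Sum>N\<in>D. L (f N)) = 0" "\<forall>N\<in>D. L (f N) \<in> N" using that by (auto simp: L.sum)
    then show ?thesis using dir unfolding direct_family_def by (metis (mono_tags, lifting))
  qed
  have "?W \<subseteq> local.span (v ` A)"
  proof
    fix w assume w: "w \<in> ?W"
    obtain f where f: "\<forall>N\<in>D. f N \<in> N" "w = (\<Sum>N\<in>D. f N)" using span by blast
    have E: "cact i E_mat (f N) = 0" if "cact i E_mat w = 0" "N \<in> D" for i N
    proof -
      have "\<forall>N\<in>D. cact i E_mat (f N) = 0"
        by (rule kernel[OF f(1)])
          (use that f irr submodule_cact in \<open>auto intro: cact_linear simp: irreducible_submodule_def\<close>)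
      then show ?thesis using that by blast
    qed
    have H: "cact i H_mat (f N) = scale c (f N)" if "cact i H_mat w = scale c w" "N \<in> D" for i N c
    proof -
      have "Vector_Spaces.linear scale scale (\<lambda>x. cact i H_mat x - scale c x)"
        by unfold_locales (simp_all add: T.H.add T.H.scale scale_right_distrib scale_right_diff_distrib mult.commute)
      moreover have "cact i H_mat x - scale c x \<in> N" if "N \<in> D" "x \<in> N" for N x
      proof (intro subspace_diff subspace_scale)
        show "cact i H_mat x \<in> N"
          using irr[OF that(1)] that(2) by (auto simp: irreducible_submodule_def intro: submodule_cact)
      qed (use irr that irreducible_subspace in auto)
      ultimately have "\<forall>N\<in>D. cact i H_mat (f N) - scale c (f N) = 0"
        using that f by (intro kernel[OF f(1)]) auto
      then show ?thesis using that by auto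
    qed
    have fW: "f N \<in> ?W" if "N \<in> D" for N
      using w E[OF _ that] H[OF _ that] by (simp add: highest_weight_space_def)
    have "f N \<in> local.span (v ` A)" if N: "N \<in> D" for N
    proof (cases "f N = 0")
      case False
      then have "N \<in> A" using fW f N by (auto simp: A_def)
      note vN = v[OF this]
      have "f N \<in> tensor_map (v N) n\<^sub>1 n\<^sub>2 n\<^sub>3 ` V_tensor n\<^sub>1 n\<^sub>2 n\<^sub>3"
        using irreducible_eq_image[OF irr[OF N], of "v N"] vN f(1) N by blast
      then obtain c where "f N = scale c (v N)"
        using highest_weight_unique[of "v N"] vN fW[OF N] by metis
      then show ?thesis using \<open>N \<in> A\<close> by (auto intro: span_scale span_base)
    qed (simp add: span_zero)
    then show "w \<in> local.span (v ` A)" unfolding f(2) by (rule span_sum)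
  qed
  moreover have "v ` A \<subseteq> ?W" using v by blast
  ultimately have "card (v ` A) = dim ?W"
    using ind(2) by (intro basis_card_eq_dim)
  moreover have "summand_count D n\<^sub>1 n\<^sub>2 n\<^sub>3 = card A"
    unfolding summand_count_def A_def
    using irreducible_isomorphic_iff[OF irr] by (intro arg_cong[of _ _ card]) auto
  ultimately show ?thesis using ind(1) by (simp add: card_image)
qed

text \<open>All decompositions give the same count and one exists, so the definite description
  denotes this dimension.\<close>

lemma multiplicity_eq_dim: "multiplicity n\<^sub>1 n\<^sub>2 n\<^sub>3 = dim (highest_weight_space n\<^sub>1 n\<^sub>2 n\<^sub>3)"
  unfolding multiplicity_def
  using irreducible_decomposition_exists summand_count_eq_dim by (intro the_equality) metis+

lemma dim_highest_weight_space:
  fixes n\<^sub>1 n\<^sub>2 n\<^sub>3 :: nat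
  defines "d \<equiv> \<lambda>(a::nat) (b::nat) (c::nat). int (dim (weight_space (of_nat a, of_nat b, of_nat c)))"
  shows "int (dim (highest_weight_space n\<^sub>1 n\<^sub>2 n\<^sub>3)) = 
      d n\<^sub>1 n\<^sub>2 n\<^sub>3
      - d (n\<^sub>1 + 2) n\<^sub>2 n\<^sub>3 - d n\<^sub>1 (n\<^sub>2 + 2) n\<^sub>3 - d n\<^sub>1 n\<^sub>2 (n\<^sub>3 + 2)
      + d (n\<^sub>1 + 2) (n\<^sub>2 + 2) n\<^sub>3 + d (n\<^sub>1 + 2) n\<^sub>2 (n\<^sub>3 + 2)
      + d n\<^sub>1 (n\<^sub>2 + 2) (n\<^sub>3 + 2)
      - d (n\<^sub>1 + 2) (n\<^sub>2 + 2) (n\<^sub>3 + 2)"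
proof -
  define wt where "wt = (\<lambda>i (n::nat) v. cact i H_mat v = scale (of_nat n) v)"
  define hw where "hw = (\<lambda>i n v. cact i E_mat v = 0 \<and> wt i n v)"
  \<comment> \<open>The intermediate dimensions, with the highest weight condition imposed on copy 0
    only, then on copies 0 and 1. Each passage is one difference in a single index.\<close>
  define d1 where "d1 = (\<lambda>a b c. dim {v. hw 0 a v \<and> wt 1 b v \<and> wt 2 c v})"
  define d2 where "d2 = (\<lambda>a b c. dim {v. hw 0 a v \<and> hw 1 b v \<and> wt 2 c v})"
  have d: "d a b c = dim {v. wt 0 a v \<and> wt 1 b v \<and> wt 2 c v}" for a b c
    by (simp add: d_def weight_space_def wt_def cact_def H_component)
  have st: "T.stable j {v \<in> S. wt i n v}" "T.stable j {v \<in> S. hw i n v}"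
    if "T.stable j S" "i \<noteq> j" for i j n S
    using stable_weight[OF that] stable_highest_weight[OF that] by (simp_all add: wt_def hw_def)
  have dimS: "dim {v \<in> S. wt i n v} = dim {v \<in> S. hw i n v} + dim {v \<in> S. wt i (n + 2) v}"
    if "T.stable i S" for i S n
    using T.dim_weight_space_eq[OF that] by (simp add: wt_def hw_def)
  have "T.stable 0 {v \<in> {v \<in> UNIV. wt 1 b v}. wt 2 c v}" for b c
    by (intro st stable_UNIV) simp_all
  from dimS[OF this] have 1: "d a b c = d1 a b c + d (a + 2) b c" for a b c
    unfolding d d1_def by (simp add: conj_ac)
  have "T.stable 1 {v \<in> {v \<in> UNIV. hw 0 a v}. wt 2 c v}" for a c
    by (intro st stable_UNIV) simp_all
  from dimS[OF this] have 2: "d1 a b c = d2 a b c + d1 a (b + 2) c" for a b c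
    unfolding d1_def d2_def by (simp add: conj_ac)
  have "T.stable 2 {v \<in> {v \<in> UNIV. hw 0 a v}. hw 1 b v}" for a b
    by (intro st stable_UNIV) simp_all
  from dimS[OF this] have 3: "d2 a b c = dim (highest_weight_space a b c) + d2 a b (c + 2)" for a b c
    unfolding d2_def highest_weight_space_def by (simp add: conj_ac hw_def wt_def)
  show ?thesis
    using 1[of n\<^sub>1 n\<^sub>2 n\<^sub>3] 1[of n\<^sub>1 "n\<^sub>2 + 2" n\<^sub>3] 1[of n\<^sub>1 n\<^sub>2 "n\<^sub>3 + 2"] 1[of n\<^sub>1 "n\<^sub>2 + 2" "n\<^sub>3 + 2"]
      2[of n\<^sub>1 n\<^sub>2 n\<^sub>3] 2[of n\<^sub>1 n\<^sub>2 "n\<^sub>3 + 2"] 3[of n\<^sub>1 n\<^sub>2 n\<^sub>3]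
    by linarith
qed

end

theorem theorem3p3:
  fixes scale :: "complex \<Rightarrow> 'v::ab_group_add \<Rightarrow> 'v"
    and act :: "mat2 \<times> mat2 \<times> mat2 \<Rightarrow> 'v \<Rightarrow> 'v"
    and n\<^sub>1 n\<^sub>2 n\<^sub>3 :: nat
  assumes "sl2_cubed_module scale act"
    and "\<exists>B. finite B \<and> module.span scale B = UNIV"
  shows "let d = \<lambda>(a::nat) (b::nat) (c::nat). int (vector_space.dim scale
      (sl2_cubed_module.weight_space scale act (of_nat a, of_nat b, of_nat c)))
    in int (sl2_cubed_module.multiplicity scale act n\<^sub>1 n\<^sub>2 n\<^sub>3) =
      d n\<^sub>1 n\<^sub>2 n\<^sub>3
      - d (n\<^sub>1 + 2) n\<^sub>2 n\<^sub>3 - d n\<^sub>1 (n\<^sub>2 + 2) n\<^sub>3 - d n\<^sub>1 n\<^sub>2 (n\<^sub>3 + 2)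
      + d (n\<^sub>1 + 2) (n\<^sub>2 + 2) n\<^sub>3 + d (n\<^sub>1 + 2) n\<^sub>2 (n\<^sub>3 + 2)
      + d n\<^sub>1 (n\<^sub>2 + 2) (n\<^sub>3 + 2)
      - d (n\<^sub>1 + 2) (n\<^sub>2 + 2) (n\<^sub>3 + 2)"
proof -
  interpret sl2_cubed_module scale act by fact
  obtain B where B: "finite B" "span B = UNIV" using assms(2) by blast
  \<comment> \<open>The finite-dimensional setting asks for a basis, which is extracted from the
    finite spanning set.\<close>
  obtain Basis where Basis: "Basis \<subseteq> B" "independent Basis" "B \<subseteq> span Basis"
    by (rule maximal_independent_subset)
  have "span Basis = UNIV"
    using B Basis(3) by (metis span_minimal subspace_span top.extremum_uniqueI)
  then interpret sl2_cubed_fd_module scale act Basis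
    by unfold_locales (use B Basis finite_subset in auto)
  show ?thesis
    unfolding Let_def multiplicity_eq_dim by (rule dim_highest_weight_space)
qed

end
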